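(* Let $(\Omega,\mathcal{A},\mathbb{P})$ be a Lebesgue probability space and $T:\Omega\to\Omega$ an invertible bimeasurable transformation which preserves $\mathbb{P}$ and is ergodic. Let $(X,d)$ be a proper metric space with base point $x_0\in X$, let $G$ be a second countable, locally compact, Hausdorff topological group acting by isometries on $X$, and let $g:\Omega\to G$ be a measurable map satisfying $\int_\Omega |g(\omega)|\,d\mathbb{P}(\omega)<\infty$, where $|g|:=d(x_0,gx_0)$ for $g\in G$. Put $Z_n(\omega)=g(\omega)g(T\omega)\cdots g(T^{n-1}\omega)$. Then, for $\mathbb{P}$-almost every $\omega$, there is some $h_\omega\in\partial X$ such that $$\lim_{n\to\infty}-\frac1n h_\omega(Z_n(\omega)x_0)=\lim_{n\to\infty}\frac1n d(x_0,Z_n(\omega)x_0).$$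
   Context: A metric space is proper if its closed bounded subsets are compact. For $x\in X$ define $\Phi_x:X\to\mathbb{R}$ by $\Phi_x(z)=d(x,z)-d(x,x_0)$. The assignment $x\mapsto\Phi_x$ is continuous, injective, and takes values in a relatively compact set of functions for the topology of uniform convergence on compact subsets of $X$; identify $X$ with its image. The metric compactification $\overline{X}$ is the closure of $X$ in this topology, and the metric boundary is $\partial X:=\overline{X}\setminus X$. Its elements, called horofunctions, are Lipschitz continuous functions $h$ on $X$ with $h(x_0)=0$.
   Formalization: The formal theorem additionally assumes that the metric boundary ∂X is nonempty; without this the claim fails (for example when X is a single point, so that no h in ∂X exists), and no case in which the claim holds is lost. *)

theory Defs
  imports "HOL-Probability.Probability"
begin

section \<open>Ergodic theory\<close>

text \<open>
  Lebesgue spaces in the sense of Rokhlin: complete probability spaces that are, up to null sets,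
  the disjoint union of an interval with Lebesgue measure (the interval may have length zero) and
  countably many point masses.  \<open>A\<close> is the set of atoms, \<open>N\<close> and \<open>K\<close> are the discarded null sets.
\<close>

definition lebesgue_probability_space :: "'w measure \<Rightarrow> bool" where
  "lebesgue_probability_space M \<longleftrightarrow>
     prob_space M \<and> complete_measure M \<and>
     (\<exists>A N (c::real) K f.
        A \<subseteq> space M \<and> countable A \<and> (\<forall>a\<in>A. {a} \<in> sets M \<and> emeasure M {a} > 0) \<and>
        N \<in> null_sets M \<and> 0 \<le> c \<and> K \<in> null_sets lebesgue \<and>
        bij_betw f (space M - A - N) ({0..c} - K) \<and>
        (\<forall>B \<subseteq> space M - A - N. B \<in> sets M \<longleftrightarrow> f ` B \<in> sets lebesgue) \<and>
        (\<forall>B \<in> sets M. B \<subseteq> space M - A - N \<longrightarrow> emeasure M B = emeasure lebesgue (f ` B)))"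

definition invertible_bimeasurable :: "'w measure \<Rightarrow> ('w \<Rightarrow> 'w) \<Rightarrow> bool" where
  "invertible_bimeasurable M T \<longleftrightarrow>
     bij_betw T (space M) (space M) \<and>
     T \<in> M \<rightarrow>\<^sub>M M \<and> inv_into (space M) T \<in> M \<rightarrow>\<^sub>M M"

definition preserves_measure :: "'w measure \<Rightarrow> ('w \<Rightarrow> 'w) \<Rightarrow> bool" where
  "preserves_measure M T \<longleftrightarrow> T \<in> M \<rightarrow>\<^sub>M M \<and> distr M M T = M"

definition ergodic :: "'w measure \<Rightarrow> ('w \<Rightarrow> 'w) \<Rightarrow> bool" where
  "ergodic M T \<longleftrightarrow>
     (\<forall>A \<in> sets M. T -` A \<inter> space M = A \<longrightarrow> measure M A = 0 \<or> measure M A = 1)"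

section \<open>Isometric actions\<close>

text \<open>
  Topological groups are instances of \<^class>\<open>topological_group_add\<close>, i.e. the (not necessarily
  commutative) group law is written \<open>+\<close> and the identity element \<open>0\<close>.
\<close>

definition isometric_action :: "('g::topological_group_add \<Rightarrow> 'x::metric_space \<Rightarrow> 'x) \<Rightarrow> bool" where
  "isometric_action act \<longleftrightarrow>
     (\<forall>x. act 0 x = x) \<and> (\<forall>a b x. act (a + b) x = act a (act b x)) \<and>
     (\<forall>a x y. dist (act a x) (act a y) = dist x y) \<and>
     continuous_on UNIV (\<lambda>(a, x). act a x)"

text \<open>The order of the factors is \<open>g \<omega> + g (T \<omega>) + ... + g ((T ^^ (n - 1)) \<omega>)\<close>.\<close>

definition cocycle :: "('w \<Rightarrow> 'w) \<Rightarrow> ('w \<Rightarrow> 'g::monoid_add) \<Rightarrow> nat \<Rightarrow> 'w \<Rightarrow> 'g" where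
  "cocycle T g n \<omega> = (\<Sum>i\<leftarrow>[0..<n]. g ((T ^^ i) \<omega>))"

section \<open>The metric compactification\<close>

definition proper_metric :: "'x::metric_space itself \<Rightarrow> bool" where
  "proper_metric _ \<longleftrightarrow> (\<forall>S :: 'x set. closed S \<and> bounded S \<longrightarrow> compact S)"

text \<open>
  The topology of uniform convergence on compact sets, given by its neighbourhoods.  It is not the
  topology of the type class instance on functions, which is that of pointwise convergence.
\<close>

definition compact_convergence :: "('x::topological_space \<Rightarrow> real) topology" where
  "compact_convergence =
     topology (\<lambda>U. \<forall>f\<in>U. \<exists>K e. compact K \<and> 0 < e \<and> {f'. \<forall>z\<in>K. \<bar>f' z - f z\<bar> < e} \<subseteq> U)"

lemma openin_compact_convergence:
  fixes U :: "('x::topological_space \<Rightarrow> real) set"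
  shows "openin compact_convergence U \<longleftrightarrow>
     (\<forall>f\<in>U. \<exists>K e. compact K \<and> 0 < e \<and> {f'. \<forall>z\<in>K. \<bar>f' z - f z\<bar> < e} \<subseteq> U)"
proof -
  let ?P = "\<lambda>U :: ('x::topological_space \<Rightarrow> real) set.
    \<forall>f\<in>U. \<exists>K e. compact K \<and> 0 < e \<and> {f'. \<forall>z\<in>K. \<bar>f' z - f z\<bar> < e} \<subseteq> U"
  have "istopology ?P"
    unfolding istopology_def
  proof (intro conjI allI impI ballI)
    fix S T :: "('x \<Rightarrow> real) set" and f assume S: "?P S" and T: "?P T" and f: "f \<in> S \<inter> T"
    obtain K e where K: "compact K" "0 < e" "{f'. \<forall>z\<in>K. \<bar>f' z - f z\<bar> < e} \<subseteq> S"
      using bspec[OF S IntD1[OF f]] by (elim exE conjE)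
    obtain L d where L: "compact L" "0 < d" "{f'. \<forall>z\<in>L. \<bar>f' z - f z\<bar> < d} \<subseteq> T"
      using bspec[OF T IntD2[OF f]] by (elim exE conjE)
    show "\<exists>K e. compact K \<and> 0 < e \<and> {f'. \<forall>z\<in>K. \<bar>f' z - f z\<bar> < e} \<subseteq> S \<inter> T"
    proof (intro exI conjI)
      show "compact (K \<union> L)" "0 < min e d" using K L by (auto intro: compact_Un)
      show "{f'. \<forall>z\<in>K \<union> L. \<bar>f' z - f z\<bar> < min e d} \<subseteq> S \<inter> T"
      proof
        fix f' assume "f' \<in> {f'. \<forall>z\<in>K \<union> L. \<bar>f' z - f z\<bar> < min e d}"
        then have "f' \<in> {f'. \<forall>z\<in>K. \<bar>f' z - f z\<bar> < e}" and "f' \<in> {f'. \<forall>z\<in>L. \<bar>f' z - f z\<bar> < d}"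
          by simp_all
        from subsetD[OF K(3) this(1)] subsetD[OF L(3) this(2)] show "f' \<in> S \<inter> T"
          by (rule IntI)
      qed
    qed
  next
    fix \<K> :: "('x \<Rightarrow> real) set set" and f assume \<K>: "\<forall>U\<in>\<K>. ?P U" and f: "f \<in> \<Union>\<K>"
    then obtain U where U: "U \<in> \<K>" "f \<in> U" by blast
    obtain K e where "compact K" "0 < e" "{f'. \<forall>z\<in>K. \<bar>f' z - f z\<bar> < e} \<subseteq> U"
      using bspec[OF bspec[OF \<K> U(1)] U(2)] by (elim exE conjE)
    moreover have "U \<subseteq> \<Union>\<K>" using U(1) by (rule Union_upper)
    ultimately show "\<exists>K e. compact K \<and> 0 < e \<and> {f'. \<forall>z\<in>K. \<bar>f' z - f z\<bar> < e} \<subseteq> \<Union>\<K>"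
      by (intro exI[of _ K] exI[of _ e]) (simp add: order_trans)
  qed
  then show ?thesis
    unfolding compact_convergence_def by (simp add: topology_inverse')
qed

lemma topspace_compact_convergence [simp]:
  "topspace compact_convergence = (UNIV :: ('x::topological_space \<Rightarrow> real) set)"
proof -
  have "openin compact_convergence (UNIV :: ('x::topological_space \<Rightarrow> real) set)"
    unfolding openin_compact_convergence using compact_empty zero_less_one by blast
  then show ?thesis
    using openin_subset by blast
qed

lemma in_closure_of_compact_convergence:
  fixes h :: "'x::topological_space \<Rightarrow> real"
  shows "h \<in> compact_convergence closure_of S \<longleftrightarrow>
     (\<forall>K e. compact K \<and> 0 < e \<longrightarrow> (\<exists>f\<in>S. \<forall>z\<in>K. \<bar>f z - h z\<bar> < e))"
proof (intro iffI allI impI)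
  fix K :: "'x set" and e :: real
  assume h: "h \<in> compact_convergence closure_of S" and K: "compact K \<and> 0 < e"
  define U where "U = {f. \<exists>d<e. \<forall>z\<in>K. \<bar>f z - h z\<bar> \<le> d}"
  have "openin compact_convergence U"
    unfolding openin_compact_convergence
  proof
    fix f assume "f \<in> U"
    then obtain d where d: "d < e" "\<forall>z\<in>K. \<bar>f z - h z\<bar> \<le> d" by (auto simp: U_def)
    have "{f'. \<forall>z\<in>K. \<bar>f' z - f z\<bar> < (e - d) / 2} \<subseteq> U"
    proof
      fix f' assume f': "f' \<in> {f'. \<forall>z\<in>K. \<bar>f' z - f z\<bar> < (e - d) / 2}"
      have "\<forall>z\<in>K. \<bar>f' z - h z\<bar> \<le> (e + d) / 2"
      proof
        fix z assume z: "z \<in> K"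
        then have "\<bar>f' z - f z\<bar> < (e - d) / 2" "\<bar>f z - h z\<bar> \<le> d" using f' d by auto
        then show "\<bar>f' z - h z\<bar> \<le> (e + d) / 2" by argo
      qed
      moreover have "(e + d) / 2 < e" using d by simp
      ultimately show "f' \<in> U" unfolding U_def by blast
    qed
    moreover have "0 < (e - d) / 2" using d by simp
    ultimately show "\<exists>K e. compact K \<and> 0 < e \<and> {f'. \<forall>z\<in>K. \<bar>f' z - f z\<bar> < e} \<subseteq> U"
      using K by blast
  qed
  moreover have "h \<in> U" unfolding U_def using K by auto
  ultimately obtain f where f: "f \<in> S" "f \<in> U" using h unfolding in_closure_of by blast
  then obtain d where "d < e" "\<forall>z\<in>K. \<bar>f z - h z\<bar> \<le> d" by (auto simp: U_def)
  then have "\<forall>z\<in>K. \<bar>f z - h z\<bar> < e" by force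
  then show "\<exists>f\<in>S. \<forall>z\<in>K. \<bar>f z - h z\<bar> < e" using f(1) by blast
next
  assume dense: "\<forall>K e. compact K \<and> 0 < e \<longrightarrow> (\<exists>f\<in>S. \<forall>z\<in>K. \<bar>f z - h z\<bar> < e)"
  have "\<exists>f\<in>S. f \<in> U" if U: "h \<in> U" "openin compact_convergence U" for U
  proof -
    obtain K e where K: "compact K" "0 < e" "{f. \<forall>z\<in>K. \<bar>f z - h z\<bar> < e} \<subseteq> U"
      using bspec[OF U(2)[unfolded openin_compact_convergence] U(1)] by (elim exE conjE)
    obtain f where f: "f \<in> S" "\<forall>z\<in>K. \<bar>f z - h z\<bar> < e"
      using dense[rule_format, OF conjI[OF K(1,2)]] by (elim bexE)
    have "f \<in> U" using f(2) by (intro subsetD[OF K(3)] CollectI)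
    with f(1) show ?thesis by blast
  qed
  then show "h \<in> compact_convergence closure_of S"
    unfolding in_closure_of by (auto simp flip: Bex_def)
qed

definition metric_embedding :: "'x::metric_space \<Rightarrow> 'x \<Rightarrow> 'x \<Rightarrow> real" where
  "metric_embedding x0 x = (\<lambda>z. dist x z - dist x x0)"

definition metric_compactification :: "'x::metric_space \<Rightarrow> ('x \<Rightarrow> real) set" where
  "metric_compactification x0 = compact_convergence closure_of (range (metric_embedding x0))"

definition metric_boundary :: "'x::metric_space \<Rightarrow> ('x \<Rightarrow> real) set" where
  "metric_boundary x0 = metric_compactification x0 - range (metric_embedding x0)"

end

theory Submission
  imports Defs
begin

text \<open>
  Write \<open>x n = Z\<^sub>n x0\<close> for the orbit of the random walk and \<open>u n = d(x0, x n)\<close>.  The action being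
  isometric, \<open>d(x n, x (n + k))\<close> equals \<open>u k\<close> evaluated at the shifted point \<open>T\<^sup>n \<omega>\<close>, so \<open>u\<close> is a
  nonnegative subadditive cocycle.  Let \<open>A\<close> be its drift, the infimum of the means of \<open>u n / n\<close>.

  The candidates for \<open>h\<close> are the cluster points of the functions \<open>\<Phi> n z = d(x n, z) - d(x n, x0)\<close>, and
  \<open>- \<Phi> n (x l) = u n \<omega> - u (n - l) (T\<^sup>l \<omega>)\<close> for \<open>l \<le> n\<close>.  If, along infinitely many times \<open>n\<close>, the right-hand
  side is at least \<open>(A - \<epsilon>) l\<close> for all \<open>l\<close> between a threshold \<open>K\<^sub>\<epsilon>\<close> and \<open>n\<close>, with thresholds for all
  \<open>\<epsilon> > 0\<close> that are independent of \<open>n\<close>, then a cluster point \<open>h\<close> along these times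
  satisfies \<open>- h (x l) \<ge> (A - \<epsilon>) l\<close> for all \<open>l \<ge> K\<^sub>\<epsilon>\<close>.  Since \<open>- h (x l) \<le> u l\<close> and \<open>u l \<le> (A + \<epsilon>) l\<close>
  eventually, both quotients in the theorem converge to \<open>A\<close>.  When \<open>A > 0\<close> the function \<open>h\<close> is
  unbounded below, hence lies in the boundary; when \<open>A = 0\<close> every boundary point will do.

  Such times exist by the argument of Gouezel and Karlsson.  Seen from the endpoint,
  these quantities form the sequence \<open>n \<mapsto> u n (T\<^sup>N\<^sup>-\<^sup>n \<omega>)\<close>, and \<open>n\<close> violates the above condition at
  \<open>T\<^sup>N\<^sup>-\<^sup>n \<omega>\<close>, i.e. is a bad time there, when it ends an interval of length at least \<open>K\<close> over which this
  sequence has slope less than \<open>A - \<epsilon>\<close>.  Elsewhere the slope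
  is hardly larger than \<open>A\<close>, because the mean of the positive part of \<open>u m / m - A\<close> tends to \<open>0\<close>
  (\<open>mean_excess_tendsto_0\<close>).  As the mean of \<open>u N\<close> is at least \<open>A N\<close>, bad times are rare
  (\<open>steep_descents_sparse\<close> for the deterministic half, \<open>steep_rare\<close> for the probabilistic one).
  Summing the densities of bad times over \<open>\<epsilon> = 1, 1/2, 1/3, \<dots>\<close> gives
  \<open>AE_infinitely_many_good_times\<close>.  The almost sure upper bound on \<open>u l / l\<close> (\<open>u_eventually_le\<close>) comes
  from the pointwise ergodic theorem, of which the one-sided estimate \<open>birkhoff_sums_linear_bound\<close>
  is the form used throughout.
\<close>

section \<open>Birkhoff sums\<close>

locale ergodic_system = prob_space M for M :: "'w measure" +
  fixes T :: "'w \<Rightarrow> 'w"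
  assumes preserves: "preserves_measure M T"
    and ergodic: "ergodic M T"
begin

lemma measurable_T [measurable]: "T \<in> M \<rightarrow>\<^sub>M M"
  using preserves by (simp add: preserves_measure_def)

lemma distr_T: "distr M M T = M"
  using preserves by (simp add: preserves_measure_def)

lemma measurable_iterate [measurable]: "(T ^^ i) \<in> M \<rightarrow>\<^sub>M M"
  by (induction i) (auto intro: measurable_comp[OF _ measurable_T] simp: measurable_ident)

lemma distr_iterate: "distr M M (T ^^ i) = M"
proof (induction i)
  case 0
  show ?case by (simp add: distr_id id_def)
next
  case (Suc i)
  have "distr M M (T ^^ Suc i) = distr (distr M M (T ^^ i)) M T"
    by (simp only: distr_distr[OF measurable_T measurable_iterate] funpow.simps)
  then show ?case by (simp only: Suc distr_T)
qed

lemma integrable_iterate: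
  fixes f :: "'w \<Rightarrow> real"
  assumes "integrable M f"
  shows "integrable M (\<lambda>\<omega>. f ((T ^^ i) \<omega>))"
  using assms integrable_distr_eq[of "T ^^ i" M M f] by (simp add: distr_iterate)

lemma integral_iterate:
  fixes f :: "'w \<Rightarrow> real"
  assumes [measurable]: "f \<in> borel_measurable M"
  shows "(\<integral>\<omega>. f ((T ^^ i) \<omega>) \<partial>M) = (\<integral>\<omega>. f \<omega> \<partial>M)"
  using integral_distr[of "T ^^ i" M M f] by (simp add: distr_iterate)

lemma prob_iterate:
  assumes "B \<in> sets M"
  shows "prob ((T ^^ i) -` B \<inter> space M) = prob B"
  using measure_distr[of "T ^^ i" M M B] assms by (simp add: distr_iterate)

definition birkhoff_sum :: "('w \<Rightarrow> real) \<Rightarrow> nat \<Rightarrow> 'w \<Rightarrow> real" where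
  "birkhoff_sum f n \<omega> = (\<Sum>i<n. f ((T ^^ i) \<omega>))"

lemma birkhoff_sum_0 [simp]: "birkhoff_sum f 0 \<omega> = 0"
  by (simp add: birkhoff_sum_def)

lemma birkhoff_sum_Suc_shift: "birkhoff_sum f (Suc n) \<omega> = f \<omega> + birkhoff_sum f n (T \<omega>)"
  unfolding birkhoff_sum_def sum.lessThan_Suc_shift by (simp add: funpow_swap1)

lemma birkhoff_sum_measurable [measurable]:
  assumes [measurable]: "f \<in> borel_measurable M"
  shows "birkhoff_sum f n \<in> borel_measurable M"
  unfolding birkhoff_sum_def by measurable

lemma birkhoff_sum_integrable: "integrable M f \<Longrightarrow> integrable M (birkhoff_sum f n)"
  unfolding birkhoff_sum_def by (intro Bochner_Integration.integrable_sum integrable_iterate)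

lemma birkhoff_sum_integral:
  "integrable M f \<Longrightarrow> (\<integral>\<omega>. birkhoff_sum f n \<omega> \<partial>M) = real n * (\<integral>\<omega>. f \<omega> \<partial>M)"
  unfolding birkhoff_sum_def
  by (subst Bochner_Integration.integral_sum) (auto simp: integral_iterate integrable_iterate)

text \<open>
  The recursion computes the maximum of the Birkhoff sums of lengths \<open>0..n\<close>, because the Birkhoff
  sums of lengths \<open>1..n + 1\<close> at \<open>\<omega>\<close> are those of lengths \<open>0..n\<close> at \<open>T \<omega>\<close>, increased by \<open>f \<omega>\<close>.
\<close>

primrec max_birkhoff_sum :: "('w \<Rightarrow> real) \<Rightarrow> nat \<Rightarrow> 'w \<Rightarrow> real" where
  "max_birkhoff_sum f 0 = (\<lambda>\<omega>. 0)"
| "max_birkhoff_sum f (Suc n) = (\<lambda>\<omega>. max 0 (f \<omega> + max_birkhoff_sum f n (T \<omega>)))"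

lemma max_birkhoff_sum_nonneg: "0 \<le> max_birkhoff_sum f n \<omega>"
  by (cases n) auto

lemma birkhoff_sum_le_max: "k \<le> n \<Longrightarrow> birkhoff_sum f k \<omega> \<le> max_birkhoff_sum f n \<omega>"
proof (induction n arbitrary: k \<omega>)
  case (Suc n)
  show ?case
  proof (cases k)
    case (Suc k')
    then have "birkhoff_sum f k' (T \<omega>) \<le> max_birkhoff_sum f n (T \<omega>)"
      using Suc.IH Suc.prems by simp
    then show ?thesis using Suc by (simp add: birkhoff_sum_Suc_shift)
  qed simp
qed simp

lemma max_birkhoff_sum_mono: "max_birkhoff_sum f n \<omega> \<le> max_birkhoff_sum f (Suc n) \<omega>"
proof (induction n arbitrary: \<omega>)
  case (Suc n)
  from Suc[of "T \<omega>"] show ?case by (simp add: max_def)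
qed simp

lemma max_birkhoff_sum_integrable:
  assumes "integrable M f"
  shows "integrable M (max_birkhoff_sum f n)"
proof (induction n)
  case (Suc n)
  then show ?case
    using integrable_iterate[OF Suc, of 1] assms by (auto intro!: integrable_max)
qed simp

text \<open>
  The set \<open>D\<close> of points with unbounded Birkhoff sums is invariant.  Let \<open>m n\<close> be the maximum of the
  Birkhoff sums up to time \<open>n\<close>.  The difference of \<open>m (n + 1)\<close> and \<open>m n \<circ> T\<close> is
  \<open>max (- m n \<circ> T) f\<close>; its mean is nonnegative, since \<open>T\<close> preserves means and \<open>m\<close> increases with \<open>n\<close>,
  and on \<open>D\<close> it converges to \<open>f\<close>.  If \<open>D\<close> had full measure, \<open>f\<close> would have a nonnegative mean.
\<close>

lemma birkhoff_sums_bounded_above: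
  assumes f: "integrable M f" and neg: "(\<integral>\<omega>. f \<omega> \<partial>M) < 0"
  shows "AE \<omega> in M. \<exists>C. \<forall>n. birkhoff_sum f n \<omega> \<le> C"
proof -
  have [measurable]: "f \<in> borel_measurable M" using f by simp
  define D where "D = {\<omega> \<in> space M. \<forall>C::nat. \<exists>n. birkhoff_sum f n \<omega> > real C}"
  have D_meas [measurable]: "D \<in> sets M" unfolding D_def by measurable
  have unbounded_iff: "(\<forall>C::nat. \<exists>n. birkhoff_sum f n \<omega> > real C) \<longleftrightarrow>
      (\<forall>C. \<exists>n. birkhoff_sum f n \<omega> > C)" for \<omega>
    by (meson less_trans reals_Archimedean2)
  have "(\<forall>C. \<exists>n. birkhoff_sum f n (T \<omega>) > C) \<longleftrightarrow> (\<forall>C. \<exists>n. birkhoff_sum f n \<omega> > C)" for \<omega>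
  proof (intro iffI allI)
    fix C assume "\<forall>C. \<exists>n. birkhoff_sum f n (T \<omega>) > C"
    then obtain n where "birkhoff_sum f n (T \<omega>) > C - f \<omega>" by blast
    then show "\<exists>n. birkhoff_sum f n \<omega> > C"
      by (intro exI[of _ "Suc n"]) (simp add: birkhoff_sum_Suc_shift)
  next
    fix C assume "\<forall>C. \<exists>n. birkhoff_sum f n \<omega> > C"
    then obtain n where n: "birkhoff_sum f n \<omega> > max 0 (C + f \<omega>)" by blast
    then obtain k where "n = Suc k" by (cases n) auto
    with n show "\<exists>n. birkhoff_sum f n (T \<omega>) > C"
      by (intro exI[of _ k]) (simp add: birkhoff_sum_Suc_shift)
  qed
  then have "T -` D \<inter> space M = D"
    unfolding D_def unbounded_iff using measurable_space[OF measurable_T] by auto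
  then have "prob D = 0 \<or> prob D = 1"
    using ergodic D_meas unfolding ergodic_def by blast
  moreover have "prob D \<noteq> 1"
  proof
    assume "prob D = 1"
    then have AE_D: "AE \<omega> in M. \<omega> \<in> D" using AE_prob_1 by blast
    define r where "r n \<omega> = max (- max_birkhoff_sum f n (T \<omega>)) (f \<omega>)" for n \<omega>
    have r_eq: "r n \<omega> = max_birkhoff_sum f (Suc n) \<omega> - max_birkhoff_sum f n (T \<omega>)" for n \<omega>
      by (simp add: r_def max_def)
    have mx: "integrable M (max_birkhoff_sum f n)"
         "integrable M (\<lambda>\<omega>. max_birkhoff_sum f n (T \<omega>))"
         "(\<integral>\<omega>. max_birkhoff_sum f n (T \<omega>) \<partial>M) = (\<integral>\<omega>. max_birkhoff_sum f n \<omega> \<partial>M)" for n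
      using max_birkhoff_sum_integrable[OF f, of n] integrable_iterate[of "max_birkhoff_sum f n" 1]
        integral_iterate[of "max_birkhoff_sum f n" 1] by auto
    have [measurable]: "r n \<in> borel_measurable M" for n
      using mx(2)[of n] unfolding r_def by measurable
    have "0 \<le> (\<integral>\<omega>. r n \<omega> \<partial>M)" for n
    proof -
      have "(\<integral>\<omega>. r n \<omega> \<partial>M) =
          (\<integral>\<omega>. max_birkhoff_sum f (Suc n) \<omega> \<partial>M) - (\<integral>\<omega>. max_birkhoff_sum f n \<omega> \<partial>M)"
        unfolding r_eq
        by (subst Bochner_Integration.integral_diff[OF mx(1) mx(2)]) (simp only: mx(3))
      moreover have "(\<integral>\<omega>. max_birkhoff_sum f n \<omega> \<partial>M) \<le> (\<integral>\<omega>. max_birkhoff_sum f (Suc n) \<omega> \<partial>M)"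
        by (intro integral_mono mx max_birkhoff_sum_mono)
      ultimately show ?thesis by simp
    qed
    moreover have "(\<lambda>n. \<integral>\<omega>. r n \<omega> \<partial>M) \<longlonglongrightarrow> (\<integral>\<omega>. f \<omega> \<partial>M)"
    proof (rule integral_dominated_convergence[where w = "\<lambda>\<omega>. \<bar>f \<omega>\<bar>"])
      show "AE \<omega> in M. (\<lambda>n. r n \<omega>) \<longlonglongrightarrow> f \<omega>"
        using AE_D
      proof eventually_elim
        case (elim \<omega>)
        then have "T \<omega> \<in> D" using \<open>T -` D \<inter> space M = D\<close> by blast
        then obtain k where k: "birkhoff_sum f k (T \<omega>) > - f \<omega>"
          unfolding D_def unbounded_iff by blast
        have "r n \<omega> = f \<omega>" if "n \<ge> k" for n
          using birkhoff_sum_le_max[OF that, of f "T \<omega>"] k by (simp add: r_def)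
        then show ?case
          by (intro tendsto_eventually) (auto simp: eventually_sequentially)
      qed
      show "AE \<omega> in M. norm (r n \<omega>) \<le> \<bar>f \<omega>\<bar>" for n
      proof (intro AE_I2)
        fix \<omega>
        show "norm (r n \<omega>) \<le> \<bar>f \<omega>\<bar>"
          using max_birkhoff_sum_nonneg[of f n "T \<omega>"] by (simp add: r_def max_def abs_if)
      qed
    qed (use f in auto)
    ultimately have "0 \<le> (\<integral>\<omega>. f \<omega> \<partial>M)" by (intro LIMSEQ_le_const) auto
    with neg show False by simp
  qed
  ultimately have "AE \<omega> in M. \<omega> \<notin> D"
    using prob_eq_0 D_meas by blast
  then show ?thesis
    by (rule AE_mp) (auto intro!: AE_I2 simp: D_def not_less)
qed

text \<open>
  Applied to \<open>f\<close> and to \<open>- f\<close>, with \<open>c\<close> close to the mean, this is the pointwise ergodic theorem.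
\<close>

lemma birkhoff_sums_linear_bound:
  assumes f: "integrable M f" and c: "(\<integral>\<omega>. f \<omega> \<partial>M) < c"
  shows "AE \<omega> in M. \<exists>C. \<forall>n. birkhoff_sum f n \<omega> \<le> c * real n + C"
proof -
  have "AE \<omega> in M. \<exists>C. \<forall>n. birkhoff_sum (\<lambda>\<omega>. f \<omega> - c) n \<omega> \<le> C"
    using f c by (intro birkhoff_sums_bounded_above) (auto simp: prob_space)
  moreover have "birkhoff_sum (\<lambda>\<omega>. f \<omega> - c) n \<omega> = birkhoff_sum f n \<omega> - c * real n" for n \<omega>
    by (simp add: birkhoff_sum_def sum_subtractf mult.commute)
  ultimately show ?thesis by (simp add: algebra_simps)
qed

end

lemma eventually_linear_bound:
  fixes x :: "nat \<Rightarrow> real"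
  assumes "\<And>n. x (n + m) \<le> c * real n + C" and "c < d"
  shows "\<forall>\<^sub>F n in sequentially. x n \<le> d * real n"
proof -
  obtain k :: nat where k: "(C - c * real m) / (d - c) < real k" using reals_Archimedean2 by blast
  have "x n \<le> d * real n" if n: "n \<ge> m + k" for n
  proof -
    have "C - c * real m \<le> (d - c) * real k" using k \<open>c < d\<close> by (simp add: field_simps)
    also have "\<dots> \<le> (d - c) * real n" using n \<open>c < d\<close> by (intro mult_left_mono) auto
    finally show ?thesis using assms(1)[of "n - m"] n by (simp add: of_nat_diff algebra_simps)
  qed
  then show ?thesis unfolding eventually_sequentially by blast
qed

section \<open>The drift of a subadditive cocycle\<close>

locale nonneg_subadditive_cocycle = ergodic_system M T
  for M :: "'w measure" and T :: "'w \<Rightarrow> 'w" +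
  fixes u :: "nat \<Rightarrow> 'w \<Rightarrow> real"
  assumes measurable_u [measurable]: "u n \<in> borel_measurable M"
    and integrable_1: "integrable M (u 1)"
    and u_0 [simp]: "u 0 \<omega> = 0"
    and u_nonneg: "0 \<le> u n \<omega>"
    and subadditive: "u (n + k) \<omega> \<le> u n \<omega> + u k ((T ^^ n) \<omega>)"
begin

lemma u_le_sum: "u (n + k) \<omega> \<le> u n \<omega> + (\<Sum>i<k. u 1 ((T ^^ (n + i)) \<omega>))"
proof (induction k)
  case (Suc k)
  have "u (n + Suc k) \<omega> \<le> u (n + k) \<omega> + u 1 ((T ^^ (n + k)) \<omega>)"
    using subadditive[of "n + k" 1 \<omega>] by simp
  with Suc show ?case by simp
qed simp

lemma u_le_birkhoff_sum: "u n \<omega> \<le> birkhoff_sum (u 1) n \<omega>"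
  using u_le_sum[of 0 n \<omega>] by (simp add: birkhoff_sum_def)

lemma integrable_u: "integrable M (u n)"
  by (rule Bochner_Integration.integrable_bound[OF birkhoff_sum_integrable[OF integrable_1, of n]])
    (auto intro!: AE_I2 order_trans[OF u_le_birkhoff_sum] simp: u_nonneg)

text \<open>
  The infimum is also the limit of the means.  Defining it as an infimum makes the lower bound
  \<open>drift_le_mean\<close> available at every \<open>n\<close>.
\<close>

definition drift :: real where
  "drift = (INF n\<in>{1..}. (\<integral>\<omega>. u n \<omega> \<partial>M) / real n)"

lemma mean_nonneg: "0 \<le> (\<integral>\<omega>. u n \<omega> \<partial>M) / real n"
  by (simp add: u_nonneg)

lemma drift_nonneg: "0 \<le> drift"
  unfolding drift_def by (intro cINF_greatest) (auto simp: mean_nonneg)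

lemma drift_le_mean: "drift * real n \<le> (\<integral>\<omega>. u n \<omega> \<partial>M)"
proof (cases "n = 0")
  case False
  have "bdd_below ((\<lambda>n. (\<integral>\<omega>. u n \<omega> \<partial>M) / real n) ` {1..})"
    by (rule bdd_belowI2[of _ 0]) (rule mean_nonneg)
  then have "drift \<le> (\<integral>\<omega>. u n \<omega> \<partial>M) / real n"
    unfolding drift_def using False by (intro cINF_lower) auto
  then show ?thesis using False by (simp add: field_simps)
qed simp

lemma mean_near_drift:
  assumes "0 < e"
  obtains m where "1 \<le> m" "(\<integral>\<omega>. u m \<omega> \<partial>M) / real m < drift + e"
proof -
  have "(INF n\<in>{1..}. (\<integral>\<omega>. u n \<omega> \<partial>M) / real n) < drift + e"
    unfolding drift_def[symmetric] using assms by simp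
  then obtain m where "m \<in> {1..}" "(\<integral>\<omega>. u m \<omega> \<partial>M) / real m < drift + e"
    by (subst (asm) cINF_less_iff) (auto intro!: bdd_belowI2[of _ 0] simp: mean_nonneg)
  then show ?thesis using that by auto
qed

text \<open>
  Averaging over a window of \<open>m\<close> consecutive times turns the \<open>m\<close>-step inequality
  \<open>u (n + m) \<le> u n + u m \<circ> T\<^sup>n\<close> into a one-step inequality: moving the window by one time adds the
  term at \<open>n + m\<close> and drops the one at \<open>n\<close>.  In this way a mean of \<open>u m / m\<close> close to the drift can be
  exploited through the Birkhoff sums for \<open>T\<close> itself, although \<open>T\<^sup>m\<close> may fail to be ergodic.
\<close>

lemma window_average_le:
  assumes m: "1 \<le> m"
  shows "(\<Sum>c<m. u (n + c) \<omega>) / real m \<le>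
    (\<Sum>c<m. u c \<omega>) / real m + birkhoff_sum (\<lambda>\<omega>. u m \<omega> / real m) n \<omega>"
proof (induction n)
  case (Suc n)
  have "(\<Sum>c<m. u (Suc n + c) \<omega>) + u n \<omega> = (\<Sum>c<Suc m. u (n + c) \<omega>)"
    by (subst sum.lessThan_Suc_shift) simp
  also have "\<dots> \<le> (\<Sum>c<m. u (n + c) \<omega>) + (u n \<omega> + u m ((T ^^ n) \<omega>))"
    using subadditive[of n m \<omega>] by simp
  finally have "(\<Sum>c<m. u (Suc n + c) \<omega>) / real m
      \<le> (\<Sum>c<m. u (n + c) \<omega>) / real m + u m ((T ^^ n) \<omega>) / real m"
    using m by (simp add: divide_right_mono add_divide_distrib[symmetric])
  with Suc show ?case by (simp add: birkhoff_sum_def)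
qed simp

lemma u_le_window_average:
  assumes m: "1 \<le> m"
  shows "u (n + m) \<omega> \<le> (\<Sum>c<m. u (n + c) \<omega>) / real m + (\<Sum>i<m. u 1 ((T ^^ (n + i)) \<omega>))"
proof -
  have "u (n + m) \<omega> \<le> u (n + c) \<omega> + (\<Sum>i<m. u 1 ((T ^^ (n + i)) \<omega>))" if "c < m" for c
  proof -
    have "u (n + m) \<omega> \<le> u (n + c) \<omega> + (\<Sum>i<m - c. u 1 ((T ^^ (n + (c + i))) \<omega>))"
      using u_le_sum[of "n + c" "m - c" \<omega>] that by (simp add: add.assoc)
    also have "(\<Sum>i<m - c. u 1 ((T ^^ (n + (c + i))) \<omega>)) = (\<Sum>i\<in>{c..<m}. u 1 ((T ^^ (n + i)) \<omega>))"
      by (rule sum.reindex_bij_witness[of _ "\<lambda>i. i - c" "\<lambda>i. c + i"]) auto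
    also have "\<dots> \<le> (\<Sum>i<m. u 1 ((T ^^ (n + i)) \<omega>))"
      by (intro sum_mono2) (auto simp: u_nonneg)
    finally show ?thesis by simp
  qed
  then have "(\<Sum>c<m. u (n + m) \<omega>) \<le> (\<Sum>c<m. u (n + c) \<omega> + (\<Sum>i<m. u 1 ((T ^^ (n + i)) \<omega>)))"
    by (intro sum_mono) auto
  then show ?thesis using m by (simp add: sum.distrib field_simps)
qed

text \<open>
  Choose \<open>m\<close> with the mean of \<open>u m / m\<close> close to the drift, and bound the Birkhoff sums of this
  function.  Passing from the window average back to \<open>u\<close> costs a block of \<open>m\<close> terms of \<open>u 1\<close>, which
  is a difference of two Birkhoff sums with the same slope.
\<close>

lemma u_eventually_le_drift_plus:
  assumes e: "0 < e"
  shows "AE \<omega> in M. \<forall>\<^sub>F n in sequentially. u n \<omega> \<le> (drift + e) * real n"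
proof -
  define \<delta> where "\<delta> = e / 8"
  have \<delta>: "0 < \<delta>" "e = 8 * \<delta>" using e by (auto simp: \<delta>_def)
  obtain m where m: "1 \<le> m" "(\<integral>\<omega>. u m \<omega> \<partial>M) / real m < drift + 2 * \<delta>"
    using mean_near_drift[of "2 * \<delta>"] \<delta> by auto
  define c where "c = (\<integral>\<omega>. u 1 \<omega> \<partial>M)"
  have "AE \<omega> in M. \<exists>C. \<forall>n. birkhoff_sum (\<lambda>\<omega>. u m \<omega> / real m) n \<omega> \<le> (drift + 2 * \<delta>) * real n + C"
    using m integrable_u[of m] by (intro birkhoff_sums_linear_bound) auto
  moreover have "AE \<omega> in M. \<exists>C. \<forall>n. birkhoff_sum (u 1) n \<omega> \<le> (c + \<delta>) * real n + C"
    using \<delta> integrable_u[of 1] by (intro birkhoff_sums_linear_bound) (auto simp: c_def)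
  moreover have "AE \<omega> in M. \<exists>C. \<forall>n. birkhoff_sum (\<lambda>\<omega>. - u 1 \<omega>) n \<omega> \<le> (- c + \<delta>) * real n + C"
    using \<delta> integrable_u[of 1] by (intro birkhoff_sums_linear_bound) (auto simp: c_def)
  ultimately show ?thesis
  proof eventually_elim
    case (elim \<omega>)
    obtain C1 where C1: "birkhoff_sum (\<lambda>\<omega>. u m \<omega> / real m) n \<omega> \<le> (drift + 2 * \<delta>) * real n + C1" for n
      using elim(1) by blast
    obtain C2 where C2: "birkhoff_sum (u 1) n \<omega> \<le> (c + \<delta>) * real n + C2" for n
      using elim(2) by blast
    obtain C3 where C3: "birkhoff_sum (\<lambda>\<omega>. - u 1 \<omega>) n \<omega> \<le> (- c + \<delta>) * real n + C3" for n
      using elim(3) by blast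
    \<comment> \<open>All terms of the final estimate that do not grow with \<open>n\<close>; the slope is
      \<open>(drift + 2 \<delta>) + (c + \<delta>) + (- c + \<delta>)\<close>.\<close>
    define C where "C = (\<Sum>c<m. u c \<omega>) / real m + C1 + C2 + C3 + (c + \<delta>) * real m"
    have "u (n + m) \<omega> \<le> (drift + 4 * \<delta>) * real n + C" for n
    proof -
      have "birkhoff_sum (u 1) n \<omega> + (\<Sum>i<m. u 1 ((T ^^ (n + i)) \<omega>)) = birkhoff_sum (u 1) (n + m) \<omega>"
        unfolding birkhoff_sum_def by (induction m) auto
      moreover have "birkhoff_sum (\<lambda>\<omega>. - u 1 \<omega>) n \<omega> = - birkhoff_sum (u 1) n \<omega>"
        by (simp add: birkhoff_sum_def sum_negf)
      ultimately have "(\<Sum>i<m. u 1 ((T ^^ (n + i)) \<omega>))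
          \<le> (c + \<delta>) * real (n + m) + C2 + (- c + \<delta>) * real n + C3"
        using C2[of "n + m"] C3[of n] by linarith
      then show ?thesis
        using u_le_window_average[OF m(1), of n \<omega>] window_average_le[OF m(1), of n \<omega>] C1[of n]
        by (simp add: C_def algebra_simps)
    qed
    then show ?case
      by (rule eventually_linear_bound) (use \<delta> in auto)
  qed
qed

lemma u_eventually_le:
  "AE \<omega> in M. \<forall>e>0. \<forall>\<^sub>F n in sequentially. u n \<omega> \<le> (drift + e) * real n"
proof -
  have "AE \<omega> in M. \<forall>k::nat. \<forall>\<^sub>F n in sequentially. u n \<omega> \<le> (drift + inverse (Suc k)) * real n"
    unfolding AE_all_countable by (intro allI u_eventually_le_drift_plus) simp
  then show ?thesis
  proof eventually_elim
    case (elim \<omega>)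
    show ?case
    proof (intro allI impI)
      fix e :: real assume "0 < e"
      then obtain k where k: "inverse (real (Suc k)) < e" using reals_Archimedean by blast
      have "(drift + inverse (Suc k)) * real n \<le> (drift + e) * real n" for n
        using k by (intro mult_right_mono) auto
      with elim[rule_format, of k] show "\<forall>\<^sub>F n in sequentially. u n \<omega> \<le> (drift + e) * real n"
        by (elim eventually_mono) (rule order_trans)
    qed
  qed
qed

end

section \<open>Steep descents of a sequence\<close>

text \<open>
  Here \<open>B\<close> consists of right endpoints of long intervals over which \<open>v\<close> grows at most at rate
  \<open>A - \<epsilon>\<close>, while \<open>v\<close> otherwise grows at rate about \<open>A\<close>, up to the errors \<open>\<phi>\<close> in blocks of
  length \<open>m\<close> and up to the cruder bound \<open>R + \<psi>\<close> for single steps.  Walk down from \<open>N\<close>, jumping over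
  the descending interval whenever the current time is in \<open>B\<close> and otherwise going one step back.
  All of \<open>B\<close> is then covered by the intervals jumped over, so \<open>v\<close> lies below \<open>A N\<close> by \<open>\<epsilon>\<close> times
  a fraction of the size of \<open>B\<close>.

  Single steps are controlled for the average \<open>V\<close> of \<open>v\<close> over a window of length \<open>m\<close>, since moving
  the window by one is a block estimate for \<open>v\<close>.  A jump has to pass from \<open>V\<close> to \<open>v\<close> at its upper
  end and back to \<open>V\<close> at its lower end, where the window must lie to the left: this uses \<open>m\<close>
  more steps and the crude step bound over two windows.  The cost \<open>2 m R\<close> is paid with half of
  the gain \<open>\<epsilon> l\<close>.  The other half pays for the at most \<open>l + m \<le> 2 l\<close> members of \<open>B\<close> passed over,
  which explains the factor \<open>\<epsilon> / 4\<close>.  The sum of \<open>\<psi>\<close> appears twice because the windows at the two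
  ends of consecutive jumps may overlap.
\<close>

lemma steep_descents_sparse:
  fixes v \<psi> \<phi> :: "nat \<Rightarrow> real"
  assumes m: "1 \<le> m" "m \<le> K" and A: "0 \<le> A" and R: "0 \<le> R" and \<epsilon>: "0 < \<epsilon>" "4 * real m * R \<le> \<epsilon> * real K"
    and v_0: "v 0 = 0"
    and step: "\<And>k. k < N + m \<Longrightarrow> v (Suc k) \<le> v k + (R + \<psi> k)"
    and block: "\<And>k. k < N \<Longrightarrow> v (k + m) \<le> v k + real m * (A + \<phi> k)"
    and nonneg: "\<And>k. 0 \<le> \<psi> k" "\<And>k. 0 \<le> \<phi> k"
    and B: "B \<subseteq> {1..N}"
    and descent: "\<And>n. n \<in> B \<Longrightarrow> \<exists>l\<in>{K..n}. v n \<le> v (n - l) + (A - \<epsilon>) * real l"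
  shows "(\<Sum>c<m. v (N + c)) / real m \<le>
    A * real N - \<epsilon> / 4 * real (card B) + real m * R + (\<Sum>k<N + m. \<psi> k) + (\<Sum>k<N. \<psi> k) + (\<Sum>k<N. \<phi> k)"
proof -
  define V where "V n = (\<Sum>c<m. v (n + c)) / real m" for n
  define \<Psi> where "\<Psi> n = (\<Sum>k<n. \<psi> k)" for n
  define \<Phi> where "\<Phi> n = (\<Sum>k<n. \<phi> k)" for n
  have \<Psi>_mono: "\<Psi> p \<le> \<Psi> q" if "p \<le> q" for p q
    unfolding \<Psi>_def using that nonneg by (intro sum_mono2) auto
  have \<Phi>_mono: "\<Phi> p \<le> \<Phi> q" if "p \<le> q" for p q
    unfolding \<Phi>_def using that nonneg by (intro sum_mono2) auto
  have \<Psi>_nonneg: "0 \<le> \<Psi> n" and \<Phi>_nonneg: "0 \<le> \<Phi> n" for n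
    unfolding \<Psi>_def \<Phi>_def using nonneg by (auto intro: sum_nonneg)
  have chain: "v (p + j) \<le> v p + (real j * R + \<Psi> (p + j) - \<Psi> p)" if "p + j \<le> N + m" for p j
    using that
  proof (induction j)
    case (Suc j)
    then have "v (p + j) \<le> v p + (real j * R + \<Psi> (p + j) - \<Psi> p)" by simp
    moreover have "v (p + Suc j) \<le> v (p + j) + (R + \<psi> (p + j))" using step[of "p + j"] Suc.prems by simp
    moreover have "\<Psi> (p + Suc j) = \<Psi> (p + j) + \<psi> (p + j)" by (simp add: \<Psi>_def)
    ultimately show ?case by (simp add: algebra_simps)
  qed simp
  have jR: "real j * R \<le> real m * R" if "j \<le> m" for j
    using that R by (intro mult_right_mono) auto
  have V_le: "V n \<le> v n + (real m * R + \<Psi> (n + m) - \<Psi> n)" if n: "n \<le> N" for n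
  proof -
    have "v (n + c) \<le> v n + (real m * R + \<Psi> (n + m) - \<Psi> n)" if c: "c < m" for c
      using chain[of n c] jR[of c] \<Psi>_mono[of "n + c" "n + m"] c n by auto
    then have "(\<Sum>c<m. v (n + c)) \<le> (\<Sum>c<m. v n + (real m * R + \<Psi> (n + m) - \<Psi> n))"
      by (intro sum_mono) auto
    then show ?thesis using m by (simp add: V_def field_simps)
  qed
  have le_V: "v (p + m) \<le> V p + (real m * R + \<Psi> (p + m) - \<Psi> p)" if p: "p \<le> N" for p
  proof -
    have "v (p + m) - (real m * R + \<Psi> (p + m) - \<Psi> p) \<le> v (p + c)" if c: "c < m" for c
      using chain[of "p + c" "m - c"] jR[of "m - c"] \<Psi>_mono[of p "p + c"] c p by auto
    then have "(\<Sum>c<m. v (p + m) - (real m * R + \<Psi> (p + m) - \<Psi> p)) \<le> (\<Sum>c<m. v (p + c))"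
      by (intro sum_mono) auto
    then show ?thesis using m by (simp add: V_def field_simps)
  qed
  have V_step: "V (Suc n) \<le> V n + (A + \<phi> n)" if n: "n < N" for n
  proof -
    have "(\<Sum>c<m. v (Suc n + c)) + v n = (\<Sum>c<Suc m. v (n + c))"
      by (subst sum.lessThan_Suc_shift) simp
    also have "\<dots> \<le> (\<Sum>c<m. v (n + c)) + (v n + real m * (A + \<phi> n))"
      using block[OF n] by simp
    finally show ?thesis using m by (simp add: V_def field_simps)
  qed
  have finB: "finite B" using B finite_subset by blast
  have card_jump: "real (card (B \<inter> {..n})) \<le> real (card (B \<inter> {..p})) + real (n - p)" for n p
  proof -
    have "card (B \<inter> {..n}) \<le> card (B \<inter> {..p} \<union> {p<..n})" using finB by (intro card_mono) auto
    also have "\<dots> \<le> card (B \<inter> {..p}) + card {p<..n}" by (rule card_Un_le)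
    finally show ?thesis by simp
  qed
  have "V n \<le> A * real n - \<epsilon> / 4 * real (card (B \<inter> {..n})) + real m * R + \<Psi> (n + m) + \<Psi> n + \<Phi> n"
    if "n \<le> N" for n
    using that
  proof (induction n rule: less_induct)
    case (less n)
    consider "n = 0" | "n \<noteq> 0" "n \<notin> B" | "n \<in> B" by blast
    then show ?case
    proof cases
      case 1
      have "B \<inter> {..0} = {}" using B by auto
      then show ?thesis using V_le[of 0] 1 v_0 by (simp add: \<Psi>_def \<Phi>_def)
    next
      case 2
      then obtain k where k: "n = Suc k" by (cases n) auto
      have "B \<inter> {..n} = B \<inter> {..k}" using 2 by (auto simp: k le_Suc_eq)
      moreover have "\<Phi> n = \<Phi> k + \<phi> k" by (simp add: \<Phi>_def k)
      ultimately show ?thesis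
        using V_step[of k] less.IH[of k] less.prems k \<Psi>_mono[of k n] \<Psi>_mono[of "k + m" "n + m"]
        by (simp add: algebra_simps)
    next
      case 3
      obtain l where l: "K \<le> l" "l \<le> n" "v n \<le> v (n - l) + (A - \<epsilon>) * real l"
        using descent[OF 3] by auto
      have lR: "4 * (real m * R) \<le> \<epsilon> * real l"
      proof -
        have "\<epsilon> * real K \<le> \<epsilon> * real l" using \<epsilon> l(1) by (intro mult_left_mono) auto
        then show ?thesis using \<epsilon>(2) by (simp only: mult.assoc)
      qed
      have ml: "\<epsilon> * real m \<le> \<epsilon> * real l" using m l \<epsilon> by (intro mult_left_mono) auto
      have Vn: "V n \<le> v (n - l) + (A - \<epsilon>) * real l + (real m * R + \<Psi> (n + m) - \<Psi> n)"
        using V_le[OF less.prems] l(3) by linarith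
      \<comment> \<open>If fewer than \<open>m\<close> times remain below the interval, the jump goes directly to time \<open>0\<close>.\<close>
      show ?thesis
      proof (cases "m \<le> n - l")
        case True
        define p where "p = n - l - m"
        have n_eq: "n = p + m + l" using True l by (simp add: p_def)
        have nl: "n - l = p + m" using n_eq by simp
        have "v (p + m) \<le> V p + (real m * R + \<Psi> (p + m) - \<Psi> p)"
          using less.prems n_eq by (intro le_V) simp
        moreover have "V p \<le> A * real p - \<epsilon> / 4 * real (card (B \<inter> {..p})) + real m * R + \<Psi> (p + m) + \<Psi> p + \<Phi> p"
          using less.prems n_eq m by (intro less.IH) auto
        moreover have "\<epsilon> / 4 * real (card (B \<inter> {..n})) \<le> \<epsilon> / 4 * (real (card (B \<inter> {..p})) + (real m + real l))"
          using card_jump[of n p] n_eq \<epsilon> by (intro mult_left_mono) auto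
        moreover have "A * real n = A * real p + A * real m + A * real l" "0 \<le> A * real m"
          using A by (auto simp: n_eq algebra_simps)
        moreover have "\<Psi> (p + m) \<le> \<Psi> n" "\<Phi> p \<le> \<Phi> n" using n_eq by (auto intro: \<Psi>_mono \<Phi>_mono)
        ultimately show ?thesis using Vn lR ml unfolding nl by (simp add: algebra_simps)
      next
        case False
        have "v (n - l) \<le> real m * R + \<Psi> (n - l)"
          using chain[of 0 "n - l"] jR[of "n - l"] False less.prems v_0 \<Psi>_nonneg[of 0] by simp
        moreover have "\<epsilon> / 4 * real (card (B \<inter> {..n})) \<le> \<epsilon> / 4 * (real m + real l)"
        proof -
          have "B \<inter> {..0} = {}" using B by auto
          then show ?thesis using card_jump[of n 0] False \<epsilon> by (intro mult_left_mono) auto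
        qed
        moreover have "A * real l \<le> A * real n" using A l by (intro mult_left_mono) auto
        moreover have "\<Psi> (n - l) \<le> \<Psi> n" by (intro \<Psi>_mono) simp
        moreover have "0 \<le> real m * R" using R by simp
        ultimately show ?thesis using Vn lR ml \<Psi>_nonneg[of n] \<Phi>_nonneg[of n] by (simp add: algebra_simps)
      qed
    qed
  qed
  from this[of N] have "V N \<le> A * real N - \<epsilon> / 4 * real (card (B \<inter> {..N})) + real m * R + \<Psi> (N + m) + \<Psi> N + \<Phi> N"
    by simp
  moreover have "B \<inter> {..N} = B" using B by auto
  ultimately show ?thesis by (simp add: V_def \<Psi>_def \<Phi>_def)
qed

section \<open>Rarity of steep descents along a cocycle\<close>

lemma (in prob_space) mean_tail_small:
  fixes f :: "'a \<Rightarrow> real"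
  assumes f: "integrable M f" and e: "0 < e"
  obtains R where "0 \<le> R" "(\<integral>\<omega>. max 0 (f \<omega> - R) \<partial>M) < e"
proof -
  have [measurable]: "f \<in> borel_measurable M" using f by simp
  have "(\<lambda>k. \<integral>\<omega>. max 0 (f \<omega> - real k) \<partial>M) \<longlonglongrightarrow> (\<integral>\<omega>. 0 \<partial>M)"
  proof (rule integral_dominated_convergence[where w = "\<lambda>\<omega>. \<bar>f \<omega>\<bar>"])
    show "AE \<omega> in M. (\<lambda>k. max 0 (f \<omega> - real k)) \<longlonglongrightarrow> 0"
    proof (intro AE_I2 tendsto_eventually)
      fix \<omega>
      obtain k :: nat where "f \<omega> < real k" using reals_Archimedean2 by blast
      then show "\<forall>\<^sub>F k in sequentially. max 0 (f \<omega> - real k) = 0"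
        unfolding eventually_sequentially by (intro exI[of _ k]) auto
    qed
  qed (use f in auto)
  then have "\<forall>\<^sub>F k in sequentially. (\<integral>\<omega>. max 0 (f \<omega> - real k) \<partial>M) < e"
    using order_tendstoD(2)[of _ 0 sequentially e] e by simp
  then obtain k :: nat where "(\<integral>\<omega>. max 0 (f \<omega> - real k) \<partial>M) < e"
    by (auto simp: eventually_sequentially)
  then show ?thesis using that[of "real k"] by simp
qed

context nonneg_subadditive_cocycle
begin

text \<open>
  Pointwise convergence to \<open>0\<close> is \<open>u_eventually_le\<close>.  For the means, the excess \<open>Z\<close> is dominated
  by the Birkhoff averages \<open>Y\<close> of \<open>u 1\<close>, whose mean \<open>c\<close> does not depend on \<open>n\<close>.  Hence it suffices to
  bound \<open>Z - (Y - c)\<close> by the uniformly bounded functions \<open>G\<close>, to which dominated convergence applies.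
\<close>

lemma mean_excess_tendsto_0:
  "(\<lambda>n. \<integral>\<omega>. max 0 (u n \<omega> / real n - drift) \<partial>M) \<longlonglongrightarrow> 0"
proof -
  define c where "c = (\<integral>\<omega>. u 1 \<omega> \<partial>M)"
  define Y where "Y n \<omega> = birkhoff_sum (u 1) n \<omega> / real n" for n \<omega>
  define Z where "Z n \<omega> = max 0 (u n \<omega> / real n - drift)" for n \<omega>
  define G where "G n \<omega> = min (Z n \<omega>) c + max 0 (c - Y n \<omega>)" for n \<omega>
  have c: "0 \<le> c" by (simp add: c_def u_nonneg)
  have Y_nonneg: "0 \<le> Y n \<omega>" and Z_nonneg: "0 \<le> Z n \<omega>" for n \<omega>
    by (auto simp: Y_def Z_def birkhoff_sum_def u_nonneg intro!: sum_nonneg divide_nonneg_nonneg)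
  have [measurable]: "Y n \<in> borel_measurable M" "Z n \<in> borel_measurable M" for n
    unfolding Y_def Z_def by measurable
  have [measurable]: "G n \<in> borel_measurable M" for n
    unfolding G_def by measurable
  have Y_int: "integrable M (Y n)" for n
    unfolding Y_def using birkhoff_sum_integrable[OF integrable_1, of n] by simp
  have Z_int: "integrable M (Z n)" for n
    unfolding Z_def using integrable_u[of n] by (intro integrable_max) auto
  have G_bound: "norm (G n \<omega>) \<le> 2 * c" for n \<omega>
    using c Y_nonneg[of n \<omega>] Z_nonneg[of n \<omega>] by (auto simp: G_def)
  have G_int: "integrable M (G n)" for n
    using G_bound by (intro integrable_const_bound[where B = "2 * c"]) auto
  have Z_le: "Z n \<omega> \<le> G n \<omega> + (Y n \<omega> - c)" for n \<omega>
  proof -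
    have "u n \<omega> / real n \<le> Y n \<omega>"
      unfolding Y_def by (intro divide_right_mono u_le_birkhoff_sum) auto
    then have "Z n \<omega> \<le> Y n \<omega>" using drift_nonneg Y_nonneg[of n \<omega>] by (simp add: Z_def)
    then show ?thesis by (simp add: G_def)
  qed
  have EZ: "(\<integral>\<omega>. Z n \<omega> \<partial>M) \<le> (\<integral>\<omega>. G n \<omega> \<partial>M)" if n: "1 \<le> n" for n
  proof -
    have "(\<integral>\<omega>. Z n \<omega> \<partial>M) \<le> (\<integral>\<omega>. G n \<omega> + (Y n \<omega> - c) \<partial>M)"
      using Z_int G_int Y_int Z_le by (intro integral_mono) auto
    also have "\<dots> = (\<integral>\<omega>. G n \<omega> \<partial>M) + ((\<integral>\<omega>. Y n \<omega> \<partial>M) - c)"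
      using G_int Y_int by (simp add: prob_space)
    also have "(\<integral>\<omega>. Y n \<omega> \<partial>M) = c"
      unfolding Y_def c_def using birkhoff_sum_integral[OF integrable_1, of n] n by simp
    finally show ?thesis by simp
  qed
  have "AE \<omega> in M. (\<lambda>n. G n \<omega>) \<longlonglongrightarrow> 0"
  proof -
    have "AE \<omega> in M. \<forall>k::nat. \<exists>C. \<forall>n. birkhoff_sum (\<lambda>\<omega>. - u 1 \<omega>) n \<omega> \<le> (- c + inverse (Suc k)) * real n + C"
      unfolding AE_all_countable using integrable_1
      by (intro allI birkhoff_sums_linear_bound) (auto simp: c_def)
    with u_eventually_le show ?thesis
    proof eventually_elim
      case (elim \<omega>)
      show ?case
      proof (rule LIMSEQ_I)
        fix r :: real assume r: "0 < r"
        define e where "e = r / 3"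
        have e: "0 < e" using r by (simp add: e_def)
        obtain k where k: "inverse (real (Suc k)) < e" using reals_Archimedean[OF e] by blast
        obtain C where "birkhoff_sum (\<lambda>\<omega>. - u 1 \<omega>) (n + 0) \<omega> \<le> (- c + inverse (Suc k)) * real n + C" for n
          using elim(2) by auto
        then have "\<forall>\<^sub>F n in sequentially. birkhoff_sum (\<lambda>\<omega>. - u 1 \<omega>) n \<omega> \<le> (- c + e) * real n"
          by (rule eventually_linear_bound) (use k in auto)
        moreover have "\<forall>\<^sub>F n in sequentially. u n \<omega> \<le> (drift + e) * real n" using elim(1) e by blast
        ultimately have "\<forall>\<^sub>F n in sequentially. norm (G n \<omega> - 0) < r"
          using eventually_ge_at_top[of 1]
        proof eventually_elim
          case (elim n)
          have "birkhoff_sum (\<lambda>\<omega>. - u 1 \<omega>) n \<omega> = - birkhoff_sum (u 1) n \<omega>"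
            by (simp add: birkhoff_sum_def sum_negf)
          with elim have "c - Y n \<omega> \<le> e" by (simp add: Y_def field_simps)
          moreover have "Z n \<omega> \<le> e" using elim e by (simp add: Z_def field_simps)
          ultimately have "G n \<omega> \<le> 2 * e" using e by (auto simp: G_def)
          moreover have "0 \<le> G n \<omega>" using Z_nonneg c by (simp add: G_def)
          ultimately show ?case using r by (simp add: e_def)
        qed
        then show "\<exists>no. \<forall>n\<ge>no. norm (G n \<omega> - 0) < r" by (simp add: eventually_sequentially)
      qed
    qed
  qed
  then have "(\<lambda>n. \<integral>\<omega>. G n \<omega> \<partial>M) \<longlonglongrightarrow> (\<integral>\<omega>. 0 \<partial>M)"
    using G_bound by (intro integral_dominated_convergence[where w = "\<lambda>_. 2 * c"]) auto
  then have "(\<lambda>n. \<integral>\<omega>. Z n \<omega> \<partial>M) \<longlonglongrightarrow> 0"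
    by (intro tendsto_sandwich[of "\<lambda>_. 0" "\<lambda>n. \<integral>\<omega>. Z n \<omega> \<partial>M" sequentially "\<lambda>n. \<integral>\<omega>. G n \<omega> \<partial>M"])
      (auto simp: eventually_sequentially Z_nonneg intro!: exI[of _ 1] EZ)
  then show ?thesis by (simp add: Z_def)
qed

text \<open>
  The points for which \<open>n\<close> is a bad time, with the slope \<open>drift - \<epsilon>\<close> and the threshold \<open>K\<close>.
\<close>

definition steep :: "real \<Rightarrow> nat \<Rightarrow> nat \<Rightarrow> 'w set" where
  "steep \<epsilon> K n = {\<omega> \<in> space M. \<exists>l\<in>{K..n}. u n \<omega> \<le> u (n - l) ((T ^^ l) \<omega>) + (drift - \<epsilon>) * real l}"

lemma steep_measurable [measurable]: "steep \<epsilon> K n \<in> sets M"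
  unfolding steep_def by measurable

text \<open>
  For fixed \<open>L = N + m\<close> the time-reversed sequence \<open>v n = u n \<circ> T\<^sup>L\<^sup>-\<^sup>n\<close> satisfies the assumptions of
  \<open>steep_descents_sparse\<close>: splitting off the first terms of the cocycle at \<open>T\<^sup>L\<^sup>-\<^sup>n \<omega>\<close> leads to an earlier
  term of the same sequence.  By invariance of the measure the terms of \<open>v\<close> have the means of \<open>u\<close>,
  and \<open>n\<close> is the endpoint of a steep descent of \<open>v\<close> with the probability of \<open>steep \<epsilon> K n\<close>.
  Integrating the deterministic estimate, the drift terms cancel.
\<close>

lemma sum_prob_steep_le:
  assumes m: "1 \<le> m" "m \<le> K" and R: "0 \<le> R" and \<epsilon>: "0 < \<epsilon>" "4 * real m * R \<le> \<epsilon> * real K"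
  shows "\<epsilon> / 4 * (\<Sum>n\<in>{1..N}. prob (steep \<epsilon> K n)) \<le>
    real m * R + (2 * real N + real m) * (\<integral>\<omega>. max 0 (u 1 \<omega> - R) \<partial>M)
      + real N * (\<integral>\<omega>. max 0 (u m \<omega> / real m - drift) \<partial>M)"
proof -
  define L where "L = N + m"
  define \<Psi> where "\<Psi> \<omega> = max 0 (u 1 \<omega> - R)" for \<omega>
  define \<Phi> where "\<Phi> \<omega> = max 0 (u m \<omega> / real m - drift)" for \<omega>
  define v where "v \<omega> n = u n ((T ^^ (L - n)) \<omega>)" for \<omega> n
  define \<psi> where "\<psi> \<omega> k = \<Psi> ((T ^^ (L - Suc k)) \<omega>)" for \<omega> k
  define \<phi> where "\<phi> \<omega> k = \<Phi> ((T ^^ (L - (k + m))) \<omega>)" for \<omega> k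
  define A where "A n = (T ^^ (L - n)) -` steep \<epsilon> K n \<inter> space M" for n
  define S where "S \<omega> = (\<Sum>n\<in>{1..N}. indicator (A n) \<omega> :: real)" for \<omega>
  have [measurable]: "\<Psi> \<in> borel_measurable M" "\<Phi> \<in> borel_measurable M"
    unfolding \<Psi>_def \<Phi>_def by measurable
  have [measurable]: "A n \<in> sets M" for n
    unfolding A_def by measurable
  have \<Psi>_int: "integrable M \<Psi>" and \<Phi>_int: "integrable M \<Phi>"
    unfolding \<Psi>_def \<Phi>_def using integrable_1 integrable_u[of m] by (auto intro!: integrable_max)
  have v_int: "integrable M (\<lambda>\<omega>. v \<omega> n)" and v_mean: "(\<integral>\<omega>. v \<omega> n \<partial>M) = (\<integral>\<omega>. u n \<omega> \<partial>M)" for n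
    unfolding v_def by (auto simp: integrable_iterate integrable_u integral_iterate)
  have \<psi>_int: "integrable M (\<lambda>\<omega>. \<psi> \<omega> n)" and \<psi>_mean: "(\<integral>\<omega>. \<psi> \<omega> n \<partial>M) = (\<integral>\<omega>. \<Psi> \<omega> \<partial>M)" for n
    unfolding \<psi>_def using \<Psi>_int by (auto simp: integrable_iterate integral_iterate)
  have \<phi>_int: "integrable M (\<lambda>\<omega>. \<phi> \<omega> n)" and \<phi>_mean: "(\<integral>\<omega>. \<phi> \<omega> n \<partial>M) = (\<integral>\<omega>. \<Phi> \<omega> \<partial>M)" for n
    unfolding \<phi>_def using \<Phi>_int by (auto simp: integrable_iterate integral_iterate)
  have A_int: "integrable M (\<lambda>\<omega>. indicator (A n) \<omega> :: real)" for n
    by (simp add: integrable_indicator_iff emeasure_eq_measure)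
  have ptw: "(\<Sum>c<m. v \<omega> (N + c)) / real m + \<epsilon> / 4 * S \<omega> \<le>
    drift * real N + real m * R + (\<Sum>k<N + m. \<psi> \<omega> k) + (\<Sum>k<N. \<psi> \<omega> k) + (\<Sum>k<N. \<phi> \<omega> k)"
    if \<omega>: "\<omega> \<in> space M" for \<omega>
  proof -
    define B where "B = {n\<in>{1..N}. \<omega> \<in> A n}"
    have "(\<Sum>c<m. v \<omega> (N + c)) / real m \<le>
      drift * real N - \<epsilon> / 4 * real (card B) + real m * R
        + (\<Sum>k<N + m. \<psi> \<omega> k) + (\<Sum>k<N. \<psi> \<omega> k) + (\<Sum>k<N. \<phi> \<omega> k)"
    proof (rule steep_descents_sparse[OF m drift_nonneg R \<epsilon>])
      show "v \<omega> 0 = 0" by (simp add: v_def)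
      show "v \<omega> (Suc k) \<le> v \<omega> k + (R + \<psi> \<omega> k)" if k: "k < N + m" for k
      proof -
        have "T ((T ^^ (L - Suc k)) \<omega>) = (T ^^ Suc (L - Suc k)) \<omega>" by simp
        also have "Suc (L - Suc k) = L - k" using k by (simp add: L_def)
        finally show ?thesis
          using subadditive[of 1 k "(T ^^ (L - Suc k)) \<omega>"] by (simp add: v_def \<psi>_def \<Psi>_def)
      qed
      show "v \<omega> (k + m) \<le> v \<omega> k + real m * (drift + \<phi> \<omega> k)" if k: "k < N" for k
      proof -
        have "(T ^^ m) ((T ^^ (L - (k + m))) \<omega>) = (T ^^ (m + (L - (k + m)))) \<omega>"
          by (simp add: funpow_add)
        also have "m + (L - (k + m)) = L - k" using k by (simp add: L_def)
        finally have "v \<omega> (k + m) \<le> u m ((T ^^ (L - (k + m))) \<omega>) + v \<omega> k"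
          using subadditive[of m k "(T ^^ (L - (k + m))) \<omega>"] by (simp add: v_def add.commute)
        moreover have "u m x \<le> real m * (drift + \<Phi> x)" for x
          using m by (simp add: \<Phi>_def field_simps max_def)
        then have "u m ((T ^^ (L - (k + m))) \<omega>) \<le> real m * (drift + \<phi> \<omega> k)"
          unfolding \<phi>_def .
        ultimately show ?thesis by linarith
      qed
      show "0 \<le> \<psi> \<omega> k" "0 \<le> \<phi> \<omega> k" for k by (simp_all add: \<psi>_def \<phi>_def \<Psi>_def \<Phi>_def)
      show "B \<subseteq> {1..N}" by (auto simp: B_def)
      show "\<exists>l\<in>{K..n}. v \<omega> n \<le> v \<omega> (n - l) + (drift - \<epsilon>) * real l" if "n \<in> B" for n
      proof -
        have n: "n \<le> N" "(T ^^ (L - n)) \<omega> \<in> steep \<epsilon> K n" using that by (auto simp: B_def A_def)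
        then obtain l where l: "l \<in> {K..n}"
          "u n ((T ^^ (L - n)) \<omega>) \<le> u (n - l) ((T ^^ l) ((T ^^ (L - n)) \<omega>)) + (drift - \<epsilon>) * real l"
          unfolding steep_def by blast
        have "(T ^^ l) ((T ^^ (L - n)) \<omega>) = (T ^^ (l + (L - n))) \<omega>" by (simp add: funpow_add)
        also have "l + (L - n) = L - (n - l)" using n l by (simp add: L_def)
        finally show ?thesis using l by (intro bexI[of _ l]) (auto simp: v_def)
      qed
    qed
    moreover have "S \<omega> = real (card B)"
      unfolding S_def B_def indicator_def by (simp add: sum.If_cases Int_def)
    ultimately show ?thesis by simp
  qed
  have "(\<integral>\<omega>. (\<Sum>c<m. v \<omega> (N + c)) / real m + \<epsilon> / 4 * S \<omega> \<partial>M) \<le>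
    (\<integral>\<omega>. drift * real N + real m * R + (\<Sum>k<N + m. \<psi> \<omega> k) + (\<Sum>k<N. \<psi> \<omega> k) + (\<Sum>k<N. \<phi> \<omega> k) \<partial>M)"
    unfolding S_def using v_int \<psi>_int \<phi>_int A_int ptw[unfolded S_def]
    by (intro integral_mono) (auto intro!: Bochner_Integration.integrable_add Bochner_Integration.integrable_sum)
  also have "\<dots> = drift * real N + real m * R + (2 * real N + real m) * (\<integral>\<omega>. \<Psi> \<omega> \<partial>M) + real N * (\<integral>\<omega>. \<Phi> \<omega> \<partial>M)"
    using \<psi>_int \<phi>_int by (simp add: prob_space \<psi>_mean \<phi>_mean algebra_simps)
  also have "(\<integral>\<omega>. (\<Sum>c<m. v \<omega> (N + c)) / real m + \<epsilon> / 4 * S \<omega> \<partial>M)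
    = (\<Sum>c<m. \<integral>\<omega>. u (N + c) \<omega> \<partial>M) / real m + \<epsilon> / 4 * (\<Sum>n\<in>{1..N}. prob (A n))"
    unfolding S_def using v_int A_int by (simp add: v_mean)
  also have "(\<Sum>n\<in>{1..N}. prob (A n)) = (\<Sum>n\<in>{1..N}. prob (steep \<epsilon> K n))"
    unfolding A_def by (simp add: prob_iterate)
  finally have "(\<Sum>c<m. \<integral>\<omega>. u (N + c) \<omega> \<partial>M) / real m + \<epsilon> / 4 * (\<Sum>n\<in>{1..N}. prob (steep \<epsilon> K n)) \<le>
    drift * real N + real m * R + (2 * real N + real m) * (\<integral>\<omega>. \<Psi> \<omega> \<partial>M) + real N * (\<integral>\<omega>. \<Phi> \<omega> \<partial>M)" .
  moreover have "drift * real N \<le> (\<Sum>c<m. \<integral>\<omega>. u (N + c) \<omega> \<partial>M) / real m"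
  proof -
    have "drift * real N \<le> (\<integral>\<omega>. u (N + c) \<omega> \<partial>M)" for c
      using drift_le_mean[of "N + c"] mult_nonneg_nonneg[OF drift_nonneg, of "real c"]
      by (simp add: distrib_left)
    then have "(\<Sum>c<m. drift * real N) \<le> (\<Sum>c<m. \<integral>\<omega>. u (N + c) \<omega> \<partial>M)" by (intro sum_mono)
    then show ?thesis using m by (simp add: field_simps)
  qed
  ultimately show ?thesis by (simp add: \<Psi>_def \<Phi>_def)
qed

text \<open>
  Choose first \<open>m\<close>, then the truncation level \<open>R\<close>, and \<open>K\<close> last.  The bound holds for
  every \<open>N\<close>, not only for large \<open>N\<close>, because there is no bad time below \<open>K\<close>.
\<close>

lemma steep_rare:
  assumes \<epsilon>: "0 < \<epsilon>" and \<eta>: "0 < \<eta>"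
  obtains K where "K0 \<le> K" "\<And>N. (\<Sum>n\<in>{1..N}. prob (steep \<epsilon> K n)) \<le> \<eta> * real N"
proof -
  \<comment> \<open>The errors will add up to \<open>4 \<delta> N\<close>, to be divided by \<open>\<epsilon> / 4\<close>.\<close>
  define \<delta> where "\<delta> = \<epsilon> * \<eta> / 32"
  have \<delta>: "0 < \<delta>" using \<epsilon> \<eta> by (simp add: \<delta>_def)
  have "\<forall>\<^sub>F n in sequentially. (\<integral>\<omega>. max 0 (u n \<omega> / real n - drift) \<partial>M) < \<delta>"
    using order_tendstoD(2)[OF mean_excess_tendsto_0 \<delta>] .
  then obtain m0 where m0: "\<And>n. m0 \<le> n \<Longrightarrow> (\<integral>\<omega>. max 0 (u n \<omega> / real n - drift) \<partial>M) < \<delta>"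
    unfolding eventually_sequentially by blast
  define m where "m = Suc m0"
  have m: "1 \<le> m" "(\<integral>\<omega>. max 0 (u m \<omega> / real m - drift) \<partial>M) < \<delta>"
    using m0[of m] by (auto simp: m_def)
  obtain R where R: "0 \<le> R" "(\<integral>\<omega>. max 0 (u 1 \<omega> - R) \<partial>M) < \<delta>"
    using mean_tail_small[OF integrable_1 \<delta>] .
  define C where "C = real m * R + real m * \<delta>"
  obtain K1 :: nat where K1: "4 * real m * R / \<epsilon> < real K1" using reals_Archimedean2 by blast
  obtain K2 :: nat where K2: "C / \<delta> < real K2" using reals_Archimedean2 by blast
  define K where "K = Max {K0, m, K1, K2}"
  have K: "K0 \<le> K" "m \<le> K" "K1 \<le> K" "K2 \<le> K" by (auto simp: K_def)
  have KR: "4 * real m * R \<le> \<epsilon> * real K"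
  proof -
    have "4 * real m * R \<le> \<epsilon> * real K1" using K1 \<epsilon> by (simp add: field_simps)
    also have "\<dots> \<le> \<epsilon> * real K" using K \<epsilon> by (intro mult_left_mono) auto
    finally show ?thesis .
  qed
  have "(\<Sum>n\<in>{1..N}. prob (steep \<epsilon> K n)) \<le> \<eta> * real N" for N
  proof (cases "N < K")
    case True
    then have "steep \<epsilon> K n = {}" if "n \<in> {1..N}" for n
      using that by (auto simp: steep_def)
    then show ?thesis using \<eta> by simp
  next
    case False
    have "\<epsilon> / 4 * (\<Sum>n\<in>{1..N}. prob (steep \<epsilon> K n)) \<le>
        real m * R + (2 * real N + real m) * (\<integral>\<omega>. max 0 (u 1 \<omega> - R) \<partial>M)
        + real N * (\<integral>\<omega>. max 0 (u m \<omega> / real m - drift) \<partial>M)"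
      by (rule sum_prob_steep_le[OF m(1) K(2) R(1) \<epsilon> KR])
    also have "\<dots> \<le> real m * R + (2 * real N + real m) * \<delta> + real N * \<delta>"
      using m R by (intro add_mono mult_left_mono) auto
    also have "\<dots> = C + 3 * \<delta> * real N" by (simp add: C_def algebra_simps)
    also have "C \<le> \<delta> * real N"
    proof -
      have "C \<le> \<delta> * real K2" using K2 \<delta> by (simp add: field_simps)
      also have "\<dots> \<le> \<delta> * real N" using K False \<delta> by (intro mult_left_mono) auto
      finally show ?thesis .
    qed
    finally have "\<epsilon> / 4 * (\<Sum>n\<in>{1..N}. prob (steep \<epsilon> K n)) \<le> \<epsilon> / 4 * (\<eta> * real N / 2)"
      by (simp add: \<delta>_def)
    then have "(\<Sum>n\<in>{1..N}. prob (steep \<epsilon> K n)) \<le> \<eta> * real N / 2"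
      using \<epsilon> by (simp only: mult_le_cancel_left_pos[of "\<epsilon> / 4"] divide_pos_pos zero_less_numeral)
    also have "\<dots> \<le> \<eta> * real N" using \<eta> by simp
    finally show ?thesis .
  qed
  then show ?thesis using that K(1) by blast
qed

end

section \<open>Times without steep descents\<close>

text \<open>
  The points lying in all \<open>B n\<close> with \<open>n \<ge> k\<close> form a subset of each of these \<open>B n\<close>, so their
  probability is at most the limit superior of the Cesaro means of the \<open>prob (B n)\<close>, for every \<open>k\<close>.
\<close>

lemma (in prob_space) prob_eventually_always_le:
  assumes [measurable]: "\<And>n. B n \<in> sets M"
    and sum: "\<And>N. (\<Sum>n\<in>{1..N}. prob (B n)) \<le> \<eta> * real N"
  shows "prob {\<omega> \<in> space M. \<exists>k. \<forall>n\<ge>k. \<omega> \<in> B n} \<le> \<eta>"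
proof -
  define F where "F k = {\<omega> \<in> space M. \<forall>n\<ge>k. \<omega> \<in> B n}" for k
  have F_meas [measurable]: "F k \<in> sets M" for k unfolding F_def by measurable
  have "prob (F k) \<le> \<eta>" for k
  proof (rule ccontr)
    assume "\<not> prob (F k) \<le> \<eta>"
    then have pos: "0 < prob (F k) - \<eta>" by simp
    obtain i :: nat where i: "\<eta> * real k / (prob (F k) - \<eta>) < real i" using reals_Archimedean2 by blast
    have "prob (F k) * real i = (\<Sum>n\<in>{Suc k..k + i}. prob (F k))" by simp
    also have "\<dots> \<le> (\<Sum>n\<in>{Suc k..k + i}. prob (B n))"
      by (intro sum_mono finite_measure_mono) (auto simp: F_def)
    also have "\<dots> \<le> (\<Sum>n\<in>{1..k + i}. prob (B n))" by (intro sum_mono2) auto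
    also have "\<dots> \<le> \<eta> * real (k + i)" by (rule sum)
    finally have "(prob (F k) - \<eta>) * real i \<le> \<eta> * real k" by (simp add: algebra_simps)
    with i pos show False by (simp add: field_simps)
  qed
  moreover have "(\<lambda>k. prob (F k)) \<longlonglongrightarrow> prob (\<Union>k. F k)"
    by (intro finite_Lim_measure_incseq) (auto simp: incseq_def F_def)
  ultimately have "prob (\<Union>k. F k) \<le> \<eta>" by (intro LIMSEQ_le_const2) auto
  moreover have "(\<Union>k. F k) = {\<omega> \<in> space M. \<exists>k. \<forall>n\<ge>k. \<omega> \<in> B n}" by (auto simp: F_def)
  ultimately show ?thesis by simp
qed

context nonneg_subadditive_cocycle
begin

text \<open>
  The bad times for the slope \<open>drift - 1 / (j + 1)\<close> are given density at most \<open>\<eta> / 2\<^sup>j\<^sup>+\<^sup>1\<close>.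
\<close>

lemma exists_thresholds:
  assumes \<eta>: "0 < \<eta>"
  shows "\<exists>K. prob {\<omega> \<in> space M. \<exists>k. \<forall>n\<ge>k. \<exists>j. \<omega> \<in> steep (inverse (Suc j)) (K j) n} \<le> \<eta>"
proof -
  \<comment> \<open>The lower bound on the thresholds ensures that only the finitely many \<open>j < n\<close> matter at time \<open>n\<close>.\<close>
  have "\<exists>K\<ge>Suc j. \<forall>N. (\<Sum>n\<in>{1..N}. prob (steep (inverse (Suc j)) K n)) \<le> \<eta> * (1 / 2) ^ Suc j * real N" for j
    by (rule steep_rare[of "inverse (Suc j)" "\<eta> * (1 / 2) ^ Suc j" "Suc j"]) (use \<eta> in auto)
  then obtain K where K: "\<And>j. Suc j \<le> K j"
    "\<And>j N. (\<Sum>n\<in>{1..N}. prob (steep (inverse (Suc j)) (K j) n)) \<le> \<eta> * (1 / 2) ^ Suc j * real N"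
    by metis
  let ?S = "\<lambda>j n. steep (inverse (Suc j)) (K j) n"
  define B where "B n = (\<Union>j<n. ?S j n)" for n
  have [measurable]: "B n \<in> sets M" for n unfolding B_def by measurable
  have B_iff: "(\<exists>j. \<omega> \<in> ?S j n) \<longleftrightarrow> \<omega> \<in> B n" for \<omega> n
  proof
    assume "\<exists>j. \<omega> \<in> ?S j n"
    then obtain j where j: "\<omega> \<in> ?S j n" by blast
    then have "K j \<le> n" by (auto simp: steep_def)
    then have "j < n" using K(1)[of j] by simp
    with j show "\<omega> \<in> B n" by (auto simp: B_def)
  qed (auto simp: B_def)
  have half: "(\<Sum>j<N. (1 / 2) ^ Suc j) \<le> (1::real)" for N
  proof -
    have "(\<Sum>j<N. (1 / 2) ^ Suc j) = (1::real) - (1 / 2) ^ N" by (induction N) auto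
    then show ?thesis by simp
  qed
  have "(\<Sum>n\<in>{1..N}. prob (B n)) \<le> \<eta> * real N" for N
  proof -
    have "(\<Sum>n\<in>{1..N}. prob (B n)) \<le> (\<Sum>n\<in>{1..N}. \<Sum>j<N. prob (?S j n))"
    proof (rule sum_mono)
      fix n assume n: "n \<in> {1..N}"
      have "prob (B n) \<le> (\<Sum>j<n. prob (?S j n))"
        unfolding B_def by (intro finite_measure_subadditive_finite) auto
      also have "\<dots> \<le> (\<Sum>j<N. prob (?S j n))" using n by (intro sum_mono2) auto
      finally show "prob (B n) \<le> (\<Sum>j<N. prob (?S j n))" .
    qed
    also have "\<dots> = (\<Sum>j<N. \<Sum>n\<in>{1..N}. prob (?S j n))" by (rule sum.swap)
    also have "\<dots> \<le> (\<Sum>j<N. \<eta> * (1 / 2) ^ Suc j * real N)" by (intro sum_mono K(2))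
    also have "\<dots> = \<eta> * real N * (\<Sum>j<N. (1 / 2) ^ Suc j)"
      by (simp add: sum_distrib_left mult_ac)
    also have "\<dots> \<le> \<eta> * real N * 1" using \<eta> half by (intro mult_left_mono) auto
    finally show ?thesis by simp
  qed
  from prob_eventually_always_le[OF _ this] show ?thesis
    by (intro exI[of _ K]) (simp only: B_iff, simp)
qed

text \<open>
  The thresholds found for \<open>\<eta> = 1 / (i + 1)\<close> fail on a set of probability at most \<open>\<eta>\<close>, so almost every
  point is served by the thresholds for some \<open>i\<close>.
\<close>

lemma AE_infinitely_many_good_times:
  "AE \<omega> in M. \<exists>K. \<exists>\<^sub>\<infinity>n. \<forall>j. \<omega> \<notin> steep (inverse (Suc j)) (K j) n"
proof -
  have "\<forall>i. \<exists>K. prob {\<omega> \<in> space M. \<exists>k. \<forall>n\<ge>k. \<exists>j. \<omega> \<in> steep (inverse (Suc j)) (K j) n} \<le> inverse (Suc i)"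
    by (intro allI exists_thresholds) simp
  from choice[OF this] obtain K where
    K: "\<And>i. prob {\<omega> \<in> space M. \<exists>k. \<forall>n\<ge>k. \<exists>j. \<omega> \<in> steep (inverse (Suc j)) (K i j) n} \<le> inverse (Suc i)"
    by (elim exE) (rule that, erule spec)
  define F where "F i = {\<omega> \<in> space M. \<exists>k. \<forall>n\<ge>k. \<exists>j. \<omega> \<in> steep (inverse (Suc j)) (K i j) n}" for i
  have F_meas [measurable]: "F i \<in> sets M" for i unfolding F_def by measurable
  have "prob (\<Inter>i. F i) \<le> inverse (Suc i)" for i
    using finite_measure_mono[of "\<Inter>i. F i" "F i"] K[of i] by (force simp: F_def)
  then have "\<not> 0 < prob (\<Inter>i. F i)"
    using reals_Archimedean[of "prob (\<Inter>i. F i)"] by (auto simp: not_less[symmetric])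
  then have "prob (\<Inter>i. F i) = 0"
    using measure_nonneg[of M "\<Inter>i. F i"] by linarith
  then have "AE \<omega> in M. \<omega> \<notin> (\<Inter>i. F i)" by (subst (asm) prob_eq_0) auto
  with AE_space show ?thesis
  proof eventually_elim
    case (elim \<omega>)
    then obtain i where "\<omega> \<notin> F i" by blast
    then have "\<exists>\<^sub>\<infinity>n. \<forall>j. \<omega> \<notin> steep (inverse (Suc j)) (K i j) n"
      using elim by (auto simp: F_def INFM_nat_le)
    then show ?case by blast
  qed
qed

end

section \<open>Horofunctions\<close>

lemma metric_embedding_lipschitz: "\<bar>metric_embedding x0 x z - metric_embedding x0 x z'\<bar> \<le> dist z z'"
  using abs_dist_diff_le[of z x z'] by (simp add: metric_embedding_def dist_commute)

lemma metric_embedding_base [simp]: "metric_embedding x0 x x0 = 0"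
  by (simp add: metric_embedding_def)

lemma abs_metric_embedding_le: "\<bar>metric_embedding x0 x z\<bar> \<le> dist x0 z"
  using metric_embedding_lipschitz[of x0 x z x0] by (simp add: dist_commute)

lemma abs_horofunction_le:
  assumes h: "h \<in> metric_compactification x0"
  shows "\<bar>h z\<bar> \<le> dist x0 z"
proof (rule field_le_epsilon)
  fix e :: real assume e: "0 < e"
  obtain x where "\<bar>metric_embedding x0 x z - h z\<bar> < e"
    using h e unfolding metric_compactification_def in_closure_of_compact_convergence
    by (auto dest!: spec[of _ "{z}"])
  then show "\<bar>h z\<bar> \<le> dist x0 z + e" using abs_metric_embedding_le[of x0 x z] by linarith
qed

text \<open>
  Tychonoff's theorem gives a cluster point \<open>h\<close> for pointwise convergence, and all functions
  involved are 1-Lipschitz, so approximation on a finite net of a compact set is uniform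
  approximation on that set.  Only the times in \<open>P\<close> are used in forming the cluster point.
\<close>

lemma compactification_cluster_point:
  fixes x :: "nat \<Rightarrow> 'x::metric_space"
  assumes inf: "\<exists>\<^sub>\<infinity>n. P n"
  obtains h where "h \<in> metric_compactification x0"
    "\<And>z e. 0 < e \<Longrightarrow> \<exists>\<^sub>\<infinity>n. P n \<and> \<bar>metric_embedding x0 (x n) z - h z\<bar> < e"
proof -
  define F where "F = filtermap (\<lambda>n. metric_embedding x0 (x n)) (inf sequentially (principal {n. P n}))"
  define box where "box = (PiE UNIV (\<lambda>z. {- dist x0 z..dist x0 z}))"
  have "compactin (product_topology (\<lambda>_. euclidean) UNIV) box"
    unfolding box_def by (subst compactin_PiE) auto
  then have box: "compact box" by (simp add: euclidean_product_topology)
  have "F \<noteq> bot"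
    using inf unfolding F_def trivial_limit_def eventually_filtermap eventually_inf_principal
    by (simp add: frequently_def cofinite_eq_sequentially)
  moreover have "eventually (\<lambda>f. f \<in> box) F"
    unfolding F_def eventually_filtermap box_def using abs_metric_embedding_le[of x0]
    by (intro always_eventually) (auto simp: abs_le_iff minus_le_iff)
  ultimately obtain h where h: "inf (nhds h) F \<noteq> bot"
    using box unfolding compact_filter by blast
  have near: "\<exists>\<^sub>\<infinity>n. P n \<and> (\<forall>z\<in>Z. \<bar>metric_embedding x0 (x n) z - h z\<bar> < e)"
    if Z: "finite Z" and e: "0 < e" for Z e
  proof (rule ccontr)
    assume "\<not> ?thesis"
    then have "\<forall>\<^sub>F f in F. \<not> (\<forall>z\<in>Z. \<bar>f z - h z\<bar> < e)"
      unfolding F_def eventually_filtermap eventually_inf_principal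
      by (simp add: frequently_def cofinite_eq_sequentially eventually_mono)
    moreover have "\<forall>\<^sub>F f in nhds h. \<forall>z\<in>Z. \<bar>f z - h z\<bar> < e"
    proof (rule eventually_ball_finite[OF Z], rule ballI)
      fix z
      have "open ((\<lambda>f::'x \<Rightarrow> real. f z) -` ball (h z) e)"
        by (intro open_vimage open_ball continuous_on_product_coordinates)
      then have "\<forall>\<^sub>F f in nhds h. f \<in> (\<lambda>f. f z) -` ball (h z) e"
        using e by (auto simp: eventually_nhds)
      then show "\<forall>\<^sub>F f in nhds h. \<bar>f z - h z\<bar> < e"
        by eventually_elim (simp add: dist_real_def abs_minus_commute)
    qed
    ultimately have "\<forall>\<^sub>F f in inf (nhds h) F. False"
      unfolding eventually_inf by blast
    with h show False by (simp add: trivial_limit_def)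
  qed
  have ex_near: "\<exists>n. \<forall>z\<in>Z. \<bar>metric_embedding x0 (x n) z - h z\<bar> < e" if "finite Z" "0 < e" for Z e
    using near[OF that] by (auto dest: frequently_ex)
  have lip: "\<bar>h z - h z'\<bar> \<le> dist z z'" for z z'
  proof (rule field_le_epsilon)
    fix e :: real assume "0 < e"
    then obtain n where "\<bar>metric_embedding x0 (x n) z - h z\<bar> < e / 2"
        "\<bar>metric_embedding x0 (x n) z' - h z'\<bar> < e / 2"
      using ex_near[of "{z, z'}" "e / 2"] by auto
    then show "\<bar>h z - h z'\<bar> \<le> dist z z' + e"
      using metric_embedding_lipschitz[of x0 "x n" z z'] by linarith
  qed
  have "h \<in> metric_compactification x0"
    unfolding metric_compactification_def in_closure_of_compact_convergence
  proof (intro allI impI)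
    fix C :: "'x set" and e :: real assume "compact C \<and> 0 < e"
    then have C: "compact C" and e: "0 < e" by auto
    obtain Z where Z: "finite Z" "C \<subseteq> (\<Union>z\<in>Z. ball z (e / 4))"
      using C e unfolding compact_eq_totally_bounded by (metis zero_less_divide_iff zero_less_numeral)
    obtain n where n: "\<forall>z\<in>Z. \<bar>metric_embedding x0 (x n) z - h z\<bar> < e / 4"
      using ex_near[OF Z(1), of "e / 4"] e by auto
    have "\<bar>metric_embedding x0 (x n) z - h z\<bar> < e" if "z \<in> C" for z
    proof -
      have "z \<in> (\<Union>z\<in>Z. ball z (e / 4))" using Z(2) that by blast
      then obtain z' where "z' \<in> Z" "dist z' z < e / 4" unfolding UN_iff mem_ball by blast
      moreover from this have "\<bar>metric_embedding x0 (x n) z' - h z'\<bar> < e / 4" using n by blast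
      ultimately show ?thesis
        using metric_embedding_lipschitz[of x0 "x n" z' z] lip[of z' z] by linarith
    qed
    then show "\<exists>f\<in>range (metric_embedding x0). \<forall>z\<in>C. \<bar>f z - h z\<bar> < e" by blast
  qed
  moreover have "\<exists>\<^sub>\<infinity>n. P n \<and> \<bar>metric_embedding x0 (x n) z - h z\<bar> < e" if "0 < e" for z e
    using near[of "{z}" e] that by simp
  ultimately show ?thesis using that by blast
qed

section \<open>Cocycles of isometries\<close>

lemma cocycle_add: "cocycle T g (n + k) \<omega> = cocycle T g n \<omega> + cocycle T g k ((T ^^ n) \<omega>)"
proof -
  have "(T ^^ (n + i)) \<omega> = (T ^^ i) ((T ^^ n) \<omega>)" for i
    by (simp only: add.commute[of n] funpow_add comp_apply)
  then show ?thesis by (induction k) (simp_all add: cocycle_def add.assoc)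
qed

lemma cocycle_measurable:
  fixes g :: "'w \<Rightarrow> 'g::{topological_monoid_add, second_countable_topology}"
  assumes [measurable]: "T \<in> M \<rightarrow>\<^sub>M M" "g \<in> M \<rightarrow>\<^sub>M borel"
  shows "cocycle T g n \<in> M \<rightarrow>\<^sub>M borel"
proof (induction n)
  case 0
  show ?case by (simp add: cocycle_def)
next
  case (Suc n)
  have [measurable]: "(T ^^ n) \<in> M \<rightarrow>\<^sub>M M"
    by (induction n) (auto intro: measurable_comp[OF _ assms(1)] simp: measurable_ident)
  have "cocycle T g (Suc n) = (\<lambda>\<omega>. cocycle T g n \<omega> + g ((T ^^ n) \<omega>))"
    by (intro ext) (simp add: cocycle_def)
  moreover have "(\<lambda>\<omega>. cocycle T g n \<omega> + g ((T ^^ n) \<omega>)) \<in> M \<rightarrow>\<^sub>M borel"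
    using Suc by measurable
  ultimately show ?case by simp
qed

theorem theorem7:
  fixes M :: "'w measure"
    and T :: "'w \<Rightarrow> 'w"
    and x0 :: "'x::metric_space"
    and act :: "'g::{topological_group_add, second_countable_topology, t2_space} \<Rightarrow> 'x \<Rightarrow> 'x"
    and g :: "'w \<Rightarrow> 'g"
  assumes "lebesgue_probability_space M"
    and "invertible_bimeasurable M T"
    and "preserves_measure M T"
    and "ergodic M T"
    and "proper_metric TYPE('x)"
    and "locally compact (UNIV :: 'g set)"
    and "isometric_action act"
    and "g \<in> M \<rightarrow>\<^sub>M borel"
    and "integrable M (\<lambda>\<omega>. dist x0 (act (g \<omega>) x0))"
    and "metric_boundary x0 \<noteq> {}"
  shows "AE \<omega> in M. \<exists>h \<in> metric_boundary x0. \<exists>l::real.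
           (\<lambda>n. - (1 / real n) * h (act (cocycle T g n \<omega>) x0)) \<longlonglongrightarrow> l \<and>
           (\<lambda>n. (1 / real n) * dist x0 (act (cocycle T g n \<omega>) x0)) \<longlonglongrightarrow> l"
proof -
  define x where "x n \<omega> = act (cocycle T g n \<omega>) x0" for n \<omega>
  define u where "u n \<omega> = dist x0 (x n \<omega>)" for n \<omega>
  have prob: "prob_space M" using assms(1) by (simp add: lebesgue_probability_space_def)
  have T_meas: "T \<in> M \<rightarrow>\<^sub>M M" using assms(3) by (simp add: preserves_measure_def)
  have act_0: "act 0 y = y" and act_add: "act (a + b) y = act a (act b y)"
    and act_dist: "dist (act a y) (act a z) = dist y z" for a b y z
    using assms(7) by (auto simp: isometric_action_def)
  have act_cont: "continuous_on UNIV (\<lambda>(a, y). act a y)"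
    using assms(7) by (auto simp: isometric_action_def)
  have dist_x: "dist (x n \<omega>) (x (n + k) \<omega>) = u k ((T ^^ n) \<omega>)" for n k \<omega>
    by (simp add: x_def u_def cocycle_add act_add act_dist)
  have u_meas: "u n \<in> borel_measurable M" for n
  proof -
    have "continuous_on UNIV (\<lambda>a. act a x0)"
      using continuous_on_compose2[OF act_cont, of UNIV "\<lambda>a. (a, x0)"]
      by (simp add: continuous_on_Pair continuous_on_id continuous_on_const)
    then have "continuous_on UNIV (\<lambda>a. dist x0 (act a x0))" by (intro continuous_intros)
    then show ?thesis
      unfolding u_def x_def using cocycle_measurable[OF T_meas assms(8), of n]
      by (rule borel_measurable_continuous_on)
  qed
  have u_subadd: "u (n + k) \<omega> \<le> u n \<omega> + u k ((T ^^ n) \<omega>)" for n k \<omega>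
    using dist_triangle[of x0 "x (n + k) \<omega>" "x n \<omega>"] by (simp add: dist_x u_def)
  have "u 1 = (\<lambda>\<omega>. dist x0 (act (g \<omega>) x0))"
    by (intro ext) (simp add: u_def x_def cocycle_def)
  then have u_int: "integrable M (u 1)" using assms(9) by simp
  interpret ergodic_system M T
    using prob assms(3,4) by (simp add: ergodic_system_def ergodic_system_axioms_def)
  interpret nonneg_subadditive_cocycle M T u
  proof
    show "u 0 \<omega> = 0" for \<omega> by (simp add: u_def x_def cocycle_def act_0)
    show "0 \<le> u n \<omega>" for n \<omega> by (simp add: u_def)
  qed (fact u_meas u_int u_subadd)+
  have upper: "- h (x n \<omega>) \<le> u n \<omega>" if "h \<in> metric_compactification x0" for h n \<omega>
    using abs_horofunction_le[OF that, of "x n \<omega>"] by (simp add: u_def)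
  \<comment> \<open>Both limits follow from one-sided bounds, of which only the lower one involves the choice of \<open>h\<close>.\<close>
  have limits: "(\<lambda>n. - (1 / real n) * h (x n \<omega>)) \<longlonglongrightarrow> drift \<and> (\<lambda>n. (1 / real n) * u n \<omega>) \<longlonglongrightarrow> drift"
    if h: "h \<in> metric_compactification x0"
      and up: "\<forall>e>0. \<forall>\<^sub>F n in sequentially. u n \<omega> \<le> (drift + e) * real n"
      and low: "\<forall>e>0. \<forall>\<^sub>F n in sequentially. (drift - e) * real n \<le> - h (x n \<omega>)"
    for h \<omega>
  proof -
    have both: "\<forall>\<^sub>F n in sequentially. drift - e \<le> - (1 / real n) * h (x n \<omega>) \<and>
        - (1 / real n) * h (x n \<omega>) \<le> (1 / real n) * u n \<omega> \<and> (1 / real n) * u n \<omega> \<le> drift + e" if e: "0 < e" for e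
      using up[rule_format, OF e] low[rule_format, OF e] eventually_ge_at_top[of 1]
    proof eventually_elim
      case (elim n)
      then show ?case using upper[OF h, of n \<omega>] by (simp add: field_simps)
    qed
    show ?thesis
      unfolding tendsto_iff
    proof (intro conjI allI impI)
      fix e :: real assume e: "0 < e"
      then have e2: "0 < e / 2" "e / 2 < e" by simp_all
      show "\<forall>\<^sub>F n in sequentially. dist (- (1 / real n) * h (x n \<omega>)) drift < e"
        using both[OF e2(1)]
      proof eventually_elim
        case (elim n)
        then show ?case using e2 unfolding dist_real_def by linarith
      qed
      show "\<forall>\<^sub>F n in sequentially. dist (1 / real n * u n \<omega>) drift < e"
        using both[OF e2(1)]
      proof eventually_elim
        case (elim n)
        then show ?case using e2 unfolding dist_real_def by linarith
      qed
    qed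
  qed
  from u_eventually_le AE_infinitely_many_good_times AE_space show ?thesis
  proof eventually_elim
    case (elim \<omega>)
    have "\<exists>h\<in>metric_boundary x0. \<forall>e>0. \<forall>\<^sub>F n in sequentially. (drift - e) * real n \<le> - h (x n \<omega>)"
    proof (cases "drift = 0")
      case True
      obtain h where h: "h \<in> metric_boundary x0" using assms(10) by blast
      then have hc: "h \<in> metric_compactification x0" by (simp add: metric_boundary_def)
      have "\<forall>\<^sub>F n in sequentially. (drift - e) * real n \<le> - h (x n \<omega>)" if e: "0 < e" for e
        using elim(1)[rule_format, OF e]
      proof eventually_elim
        case (elim n)
        then show ?case
          using abs_horofunction_le[OF hc, of "x n \<omega>"] True by (simp add: u_def)
      qed
      with h show ?thesis by blast
    next
      case False
      then have pos: "0 < drift" using drift_nonneg by simp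
      obtain K where K: "\<exists>\<^sub>\<infinity>n. \<forall>j. \<omega> \<notin> steep (inverse (Suc j)) (K j) n" using elim(2) by blast
      obtain h where h: "h \<in> metric_compactification x0"
        "\<And>z e. 0 < e \<Longrightarrow> \<exists>\<^sub>\<infinity>n. (\<forall>j. \<omega> \<notin> steep (inverse (Suc j)) (K j) n) \<and>
           \<bar>metric_embedding x0 (x n \<omega>) z - h z\<bar> < e"
        using compactification_cluster_point[OF K, of x0 "\<lambda>n. x n \<omega>"] by blast
      have h_low: "(drift - inverse (Suc j)) * real l \<le> - h (x l \<omega>)" if l: "K j \<le> l" for j l
      proof (rule field_le_epsilon)
        fix e :: real assume e: "0 < e"
        from h(2)[OF e, of "x l \<omega>"] obtain n where n: "l \<le> n" "\<omega> \<notin> steep (inverse (Suc j)) (K j) n"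
          "\<bar>metric_embedding x0 (x n \<omega>) (x l \<omega>) - h (x l \<omega>)\<bar> < e"
          unfolding INFM_nat_le by blast
        have "metric_embedding x0 (x n \<omega>) (x l \<omega>) = u (n - l) ((T ^^ l) \<omega>) - u n \<omega>"
          using dist_x[of l \<omega> "n - l"] n(1)
          by (simp add: metric_embedding_def u_def dist_commute)
        moreover have "\<not> u n \<omega> \<le> u (n - l) ((T ^^ l) \<omega>) + (drift - inverse (Suc j)) * real l"
          using n(1,2) l elim(3) unfolding steep_def by auto
        ultimately show "(drift - inverse (Suc j)) * real l \<le> - h (x l \<omega>) + e" using n(3) by linarith
      qed
      have low: "\<forall>\<^sub>F n in sequentially. (drift - e) * real n \<le> - h (x n \<omega>)" if e: "0 < e" for e
      proof -
        obtain j where j: "inverse (real (Suc j)) < e" using reals_Archimedean[OF e] by blast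
        have "(drift - e) * real n \<le> - h (x n \<omega>)" if n: "K j \<le> n" for n
        proof -
          have "(drift - e) * real n \<le> (drift - inverse (Suc j)) * real n"
            using j by (intro mult_right_mono) auto
          then show ?thesis using h_low[OF n] by linarith
        qed
        then show ?thesis unfolding eventually_sequentially by blast
      qed
      \<comment> \<open>A function in the image of the space is bounded below, but \<open>h\<close> tends to minus infinity along the orbit.\<close>
      have "h \<notin> range (metric_embedding x0)"
      proof
        assume "h \<in> range (metric_embedding x0)"
        then obtain y where y: "h = metric_embedding x0 y" by blast
        have "\<forall>\<^sub>F n in sequentially. drift / 2 * real n \<le> dist y x0"
          using low[OF half_gt_zero[OF pos]]
        proof eventually_elim
          case (elim n)
          moreover have "- h (x n \<omega>) \<le> dist y x0" by (simp add: y metric_embedding_def)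
          ultimately show ?case by (simp add: field_simps)
        qed
        then obtain n0 where n0: "\<And>n. n0 \<le> n \<Longrightarrow> drift / 2 * real n \<le> dist y x0"
          unfolding eventually_sequentially by blast
        obtain k :: nat where k: "dist y x0 / (drift / 2) < real k" using reals_Archimedean2 by blast
        have "dist y x0 < drift / 2 * real k" using k pos by (simp add: field_simps)
        also have "\<dots> \<le> drift / 2 * real (max n0 k)" using pos by (intro mult_left_mono) auto
        also have "\<dots> \<le> dist y x0" by (rule n0) simp
        finally show False by simp
      qed
      with h(1) low show ?thesis unfolding metric_boundary_def by blast
    qed
    then obtain h where h: "h \<in> metric_boundary x0"
      and low: "\<forall>e>0. \<forall>\<^sub>F n in sequentially. (drift - e) * real n \<le> - h (x n \<omega>)" by blast
    have "h \<in> metric_compactification x0" using h by (simp add: metric_boundary_def)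
    from limits[OF this elim(1) low] h show ?case unfolding u_def x_def by blast
  qed
qed

end
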